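(* Let $\rho>2$. Any embedded free boundary minimal disc $\Sigma$ in the toroid $M^\rho$ coincides, up to a rotation around the $x_3$-axis, with the vertical planar slice $M^\rho_0=\{(\rho+a,0,b) : a^2+b^2\leq 1\}$.
   Context: For $\rho>2$ the toroid is $$M^\rho=\Bigl\{(x_1,x_2,x_3)\in\mathbb{R}^3 : \bigl(\sqrt{x_1^2+x_2^2}-\rho\bigr)^2+x_3^2\leq 1\Bigr\},$$ equipped with the Euclidean metric. A free boundary minimal surface in $M^\rho$ is a compact surface $\Sigma\subset M^\rho$ with $\partial\Sigma\subset\partial M^\rho$ which has vanishing mean curvature and meets $\partial M^\rho$ orthogonally along $\partial\Sigma$. A free boundary minimal disc is a free boundary minimal surface homeomorphic to the closed unit disc. *)

theory Defs
  imports "HOL-Analysis.Analysis"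
begin

primrec times_differentiable_on ::
  "nat \<Rightarrow> ('a::real_normed_vector \<Rightarrow> 'b::real_normed_vector) \<Rightarrow> 'a set \<Rightarrow> bool"
where
  "times_differentiable_on 0 f W \<longleftrightarrow> continuous_on W f"
| "times_differentiable_on (Suc n) f W \<longleftrightarrow>
     (\<forall>x\<in>W. f differentiable (at x)) \<and>
     (\<forall>v. times_differentiable_on n (\<lambda>x. frechet_derivative f (at x) v) W)"

text \<open>Class $C^\infty$; intended for open sets \<open>W\<close>, since the derivatives are taken in the
  whole space.\<close>

definition smooth_on ::
  "('a::real_normed_vector \<Rightarrow> 'b::real_normed_vector) \<Rightarrow> 'a set \<Rightarrow> bool" where
  "smooth_on f W \<longleftrightarrow> (\<forall>n. times_differentiable_on n f W)"

definition half_plane :: "(real^2) set" where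
  "half_plane = {u. 0 \<le> u $ 2}"

text \<open>A local parametrization of \<open>S\<close> as an embedded surface with boundary. Its domain is the
  relatively open part \<open>W \<inter> half_plane\<close> of the closed half plane. Smoothness up to the boundary
  means, as usual, that \<open>X\<close> is (the restriction of) a smooth map on the open set \<open>W\<close> of the plane;
  the first and second derivatives of \<open>X\<close> at points of \<open>W \<inter> half_plane\<close> do not depend on this
  extension. Parametrizations near interior points have \<open>W\<close> inside the open half plane.\<close>

definition local_parametrization ::
  "(real^3) set \<Rightarrow> (real^2) set \<Rightarrow> (real^2 \<Rightarrow> real^3) \<Rightarrow> bool" where
  "local_parametrization S W X \<longleftrightarrow>
     open W \<and> smooth_on X W \<and>
     (\<forall>u \<in> W \<inter> half_plane. inj (frechet_derivative X (at u))) \<and>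
     openin (top_of_set S) (X ` (W \<inter> half_plane)) \<and>
     (\<exists>Y. homeomorphism (W \<inter> half_plane) (X ` (W \<inter> half_plane)) X Y)"

definition embedded_surface :: "(real^3) set \<Rightarrow> bool" where
  "embedded_surface S \<longleftrightarrow>
     (\<forall>p\<in>S. \<exists>W X. local_parametrization S W X \<and> p \<in> X ` (W \<inter> half_plane))"

definition surface_boundary :: "(real^3) set \<Rightarrow> (real^3) set" where
  "surface_boundary S =
     {X u | W X u. local_parametrization S W X \<and> u \<in> W \<and> u $ 2 = 0}"

text \<open>At a point of an embedded surface all local parametrizations yield the same plane, so the
  union over all of them taken here is the usual tangent plane (the full plane also at boundary
  points).\<close>

definition tangent_space :: "(real^3) set \<Rightarrow> real^3 \<Rightarrow> (real^3) set" where
  "tangent_space S p =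
     {frechet_derivative X (at u) v | W X u v.
        local_parametrization S W X \<and> u \<in> W \<inter> half_plane \<and> X u = p}"

definition normal_space :: "(real^3) set \<Rightarrow> real^3 \<Rightarrow> (real^3) set" where
  "normal_space S p = {n. \<forall>t \<in> tangent_space S p. orthogonal n t}"

definition meet_orthogonally_at :: "(real^3) set \<Rightarrow> (real^3) set \<Rightarrow> real^3 \<Rightarrow> bool" where
  "meet_orthogonally_at S T p \<longleftrightarrow>
     (\<forall>m \<in> normal_space S p. \<forall>n \<in> normal_space T p. orthogonal m n)"

definition partial :: "2 \<Rightarrow> (real^2 \<Rightarrow> real^3) \<Rightarrow> real^2 \<Rightarrow> real^3" where
  "partial i X u = frechet_derivative X (at u) (axis i 1)"

definition unit_normal :: "(real^2 \<Rightarrow> real^3) \<Rightarrow> real^2 \<Rightarrow> real^3" where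
  "unit_normal X u = sgn (cross3 (partial 1 X u) (partial 2 X u))"

definition first_form :: "(real^2 \<Rightarrow> real^3) \<Rightarrow> real^2 \<Rightarrow> 2 \<Rightarrow> 2 \<Rightarrow> real" where
  "first_form X u i j = partial i X u \<bullet> partial j X u"

definition second_form :: "(real^2 \<Rightarrow> real^3) \<Rightarrow> real^2 \<Rightarrow> 2 \<Rightarrow> 2 \<Rightarrow> real" where
  "second_form X u i j = partial i (partial j X) u \<bullet> unit_normal X u"

text \<open>The classical formula $H = (eG - 2fF + gE) / (2(EG - F^2))$ for half the trace of the
  second with respect to the first fundamental form.\<close>

definition mean_curvature :: "(real^2 \<Rightarrow> real^3) \<Rightarrow> real^2 \<Rightarrow> real" where
  "mean_curvature X u =
     (second_form X u 1 1 * first_form X u 2 2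
        - 2 * second_form X u 1 2 * first_form X u 1 2
        + second_form X u 2 2 * first_form X u 1 1)
     / (2 * (first_form X u 1 1 * first_form X u 2 2 - (first_form X u 1 2)\<^sup>2))"

definition minimal_surface :: "(real^3) set \<Rightarrow> bool" where
  "minimal_surface S \<longleftrightarrow> embedded_surface S \<and>
     (\<forall>W X. local_parametrization S W X \<longrightarrow>
        (\<forall>u \<in> W \<inter> half_plane. mean_curvature X u = 0))"

text \<open>For the domains \<open>M\<close> considered here, the boundary of \<open>M\<close> is its topological frontier.\<close>

definition embedded_free_boundary_minimal_surface ::
  "(real^3) set \<Rightarrow> (real^3) set \<Rightarrow> bool" where
  "embedded_free_boundary_minimal_surface M S \<longleftrightarrow>
     compact S \<and> S \<subseteq> M \<and> minimal_surface S \<and>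
     surface_boundary S \<subseteq> frontier M \<and>
     (\<forall>p \<in> surface_boundary S. meet_orthogonally_at S (frontier M) p)"

definition embedded_free_boundary_minimal_disc ::
  "(real^3) set \<Rightarrow> (real^3) set \<Rightarrow> bool" where
  "embedded_free_boundary_minimal_disc M S \<longleftrightarrow>
     embedded_free_boundary_minimal_surface M S \<and>
     S homeomorphic (cball 0 1 :: (real^2) set)"

definition toroid :: "real \<Rightarrow> (real^3) set" where
  "toroid \<rho> = {x. (sqrt ((x$1)\<^sup>2 + (x$2)\<^sup>2) - \<rho>)\<^sup>2 + (x$3)\<^sup>2 \<le> 1}"

definition vertical_slice :: "real \<Rightarrow> (real^3) set" where
  "vertical_slice \<rho> = {vector [\<rho> + a, 0, b] | a b. a\<^sup>2 + b\<^sup>2 \<le> 1}"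

definition rotation_x3 :: "real \<Rightarrow> real^3 \<Rightarrow> real^3" where
  "rotation_x3 \<theta> x =
     vector [cos \<theta> * x$1 - sin \<theta> * x$2, sin \<theta> * x$1 + cos \<theta> * x$2, x$3]"

end

theory Submission
  imports Defs
begin

text \<open>The disc is simply connected, so the angle around the \<open>x\<^sub>3\<close>-axis lifts to a continuous real
  function on it. At a point where this angle is maximal the surface touches a vertical half plane
  from one side, so the coordinate function \<open>X \<bullet> w\<close>, with \<open>w\<close> the normal of the half plane, has a
  local maximum. On a minimal surface coordinate functions solve a linear elliptic equation without
  zeroth order term, and as the half plane meets the torus orthogonally, the free boundary condition
  makes the gradient of \<open>X \<bullet> w\<close> vanish at a boundary contact point as well. The strong maximum
  principle and Hopf's boundary point lemma show that the surface lies in the half plane near every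
  contact point; by connectedness it lies in one planar slice, and by invariance of domain it is
  the whole slice.\<close>

section \<open>The strong maximum principle in the half plane\<close>

text \<open>The function \<open>X \<bullet> w\<close> vanishes on a whole plane, not only on a half
  plane, so its sign carries information about the angle only where the lifted angle is within
  \<open>pi\<close> of its maximum. Comparison is therefore local, at every point of maximal angle
  separately. In isothermal coordinates \<open>X \<bullet> w\<close> would be harmonic. The charts
  here are arbitrary, which forces an elliptic operator with variable coefficients and first order
  terms. Moreover a chart is smooth on an open set of the plane, while minimality is known only on
  its part in the closed half plane. For this reason the maximum principle takes derivatives on an
  open set but assumes the equation, the ellipticity and the sign only on the half plane.\<close>

lemma second_difference_mvt:
  fixes f :: "'a::real_normed_vector \<Rightarrow> real"
  assumes "0 < h"
    and f': "\<And>s t. \<lbrakk>0 \<le> s; s \<le> h; 0 \<le> t; t \<le> h\<rbrakk> \<Longrightarrow>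
      (f has_derivative f' (x + s *\<^sub>R v + t *\<^sub>R w)) (at (x + s *\<^sub>R v + t *\<^sub>R w))"
    and f'': "\<And>s t. \<lbrakk>0 \<le> s; s \<le> h; 0 \<le> t; t \<le> h\<rbrakk> \<Longrightarrow>
      ((\<lambda>y. f' y v) has_derivative f'' (x + s *\<^sub>R v + t *\<^sub>R w)) (at (x + s *\<^sub>R v + t *\<^sub>R w))"
  shows "\<exists>s\<in>{0..h}. \<exists>t\<in>{0..h}.
    f (x + h *\<^sub>R v + h *\<^sub>R w) - f (x + h *\<^sub>R v) - f (x + h *\<^sub>R w) + f x
      = h\<^sup>2 * f'' (x + s *\<^sub>R v + t *\<^sub>R w) w"
proof -
  \<comment> \<open>The second difference of \<open>f\<close> over the parallelogram is a first
    difference of \<open>g\<close>. The mean value theorem along \<open>v\<close> and then along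
    \<open>w\<close> turns it into a second derivative at one intermediate point.\<close>
  define g where "g s = f (x + s *\<^sub>R v + h *\<^sub>R w) - f (x + s *\<^sub>R v)" for s
  have dg: "(g has_real_derivative f' (x + s *\<^sub>R v + h *\<^sub>R w) v - f' (x + s *\<^sub>R v) v) (at s)"
    if "0 \<le> s" "s \<le> h" for s
  proof -
    have lin: "linear (f' (x + s *\<^sub>R v + h *\<^sub>R w))" "linear (f' (x + s *\<^sub>R v))"
      using f'[of s h] f'[of s 0] that \<open>0 < h\<close> by (auto intro: has_derivative_linear)
    have 1: "((\<lambda>s. f (x + s *\<^sub>R v + h *\<^sub>R w)) has_derivative (\<lambda>r. f' (x + s *\<^sub>R v + h *\<^sub>R w) (r *\<^sub>R v))) (at s)"
      by (rule has_derivative_compose[where g=f and f="\<lambda>s. x + s *\<^sub>R v + h *\<^sub>R w", OF _ f'[of s h]])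
        (use that \<open>0 < h\<close> in \<open>auto intro!: derivative_eq_intros\<close>)
    have 2: "((\<lambda>s. f (x + s *\<^sub>R v)) has_derivative (\<lambda>r. f' (x + s *\<^sub>R v) (r *\<^sub>R v))) (at s)"
      by (rule has_derivative_compose[where g=f and f="\<lambda>s. x + s *\<^sub>R v", OF _ f'[of s 0, simplified]])
        (use that \<open>0 < h\<close> in \<open>auto intro!: derivative_eq_intros\<close>)
    show ?thesis
      unfolding has_field_derivative_def g_def
      by (rule has_derivative_eq_rhs[OF has_derivative_diff[OF 1 2]])
        (auto simp: fun_eq_iff linear_cmul[OF lin(1)] linear_cmul[OF lin(2)] right_diff_distrib mult.commute)
  qed
  obtain s where s: "0 < s" "s < h"
    and gs: "g h - g 0 = (h - 0) * (f' (x + s *\<^sub>R v + h *\<^sub>R w) v - f' (x + s *\<^sub>R v) v)"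
    using MVT2[of 0 h g, OF \<open>0 < h\<close> dg] by blast
  define k where "k t = f' (x + s *\<^sub>R v + t *\<^sub>R w) v" for t
  have dk: "(k has_real_derivative f'' (x + s *\<^sub>R v + t *\<^sub>R w) w) (at t)" if "0 \<le> t" "t \<le> h" for t
  proof -
    have lin: "linear (f'' (x + s *\<^sub>R v + t *\<^sub>R w))"
      using f''[of s t] that s by (auto intro: has_derivative_linear)
    have 1: "((\<lambda>t. f' (x + s *\<^sub>R v + t *\<^sub>R w) v) has_derivative (\<lambda>r. f'' (x + s *\<^sub>R v + t *\<^sub>R w) (r *\<^sub>R w))) (at t)"
      by (rule has_derivative_compose[where g="\<lambda>y. f' y v" and f="\<lambda>t. x + s *\<^sub>R v + t *\<^sub>R w", OF _ f''[of s t]])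
        (use that s in \<open>auto intro!: derivative_eq_intros\<close>)
    show ?thesis
      unfolding has_field_derivative_def k_def
      by (rule has_derivative_eq_rhs[OF 1]) (auto simp: fun_eq_iff linear_cmul[OF lin])
  qed
  obtain t where t: "0 < t" "t < h" and kt: "k h - k 0 = (h - 0) * f'' (x + s *\<^sub>R v + t *\<^sub>R w) w"
    using MVT2[of 0 h k, OF \<open>0 < h\<close> dk] by blast
  have "g h - g 0 = h\<^sup>2 * f'' (x + s *\<^sub>R v + t *\<^sub>R w) w"
    using gs kt by (simp add: k_def power2_eq_square)
  then show ?thesis
    using s t by (intro bexI[of _ s] bexI[of _ t]) (auto simp: g_def)
qed

text \<open>The second difference over a parallelogram does not distinguish its two sides. Evaluated
  in both orders it equals the two mixed derivatives at two nearby points, and continuity carries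
  this equality to \<open>x\<close> as the parallelogram shrinks.\<close>

lemma second_derivative_symmetric:
  fixes f :: "'a::real_normed_vector \<Rightarrow> real"
  assumes "open W" "x \<in> W"
    and f': "\<And>y. y \<in> W \<Longrightarrow> (f has_derivative f' y) (at y)"
    and v: "\<And>y. y \<in> W \<Longrightarrow> ((\<lambda>y. f' y v) has_derivative Dv y) (at y)"
    and w: "\<And>y. y \<in> W \<Longrightarrow> ((\<lambda>y. f' y w) has_derivative Dw y) (at y)"
    and cv: "continuous_on W (\<lambda>y. Dv y w)" and cw: "continuous_on W (\<lambda>y. Dw y v)"
  shows "Dv x w = Dw x v"
proof (rule ccontr)
  assume "\<not> Dv x w = Dw x v"
  define e where "e = dist (Dv x w) (Dw x v) / 2"
  have "e > 0" using \<open>\<not> Dv x w = Dw x v\<close> by (simp add: e_def)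
  have "isCont (\<lambda>y. Dv y w) x" "isCont (\<lambda>y. Dw y v) x"
    using assms by (auto simp: continuous_on_eq_continuous_at)
  then obtain d1 d2 where d: "d1 > 0" "d2 > 0"
    and 1: "\<And>y. dist y x < d1 \<Longrightarrow> dist (Dv y w) (Dv x w) < e"
    and 2: "\<And>y. dist y x < d2 \<Longrightarrow> dist (Dw y v) (Dw x v) < e"
    using \<open>e > 0\<close> unfolding continuous_at_eps_delta by metis
  obtain d3 where d3: "d3 > 0" "ball x d3 \<subseteq> W"
    using assms openE by blast
  define d where "d = Min {d1, d2, d3}"
  have "d > 0" using d d3 by (simp add: d_def)
  \<comment> \<open>Small enough that the parallelogram with sides \<open>h *\<^sub>R v\<close> and
    \<open>h *\<^sub>R w\<close> stays within distance \<open>d\<close> of \<open>x\<close>.\<close>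
  define h where "h = d / (2 * (norm v + norm w + 1))"
  have nz: "norm v + norm w + 1 > 0"
    by (smt (verit) norm_ge_zero)
  have "h > 0" using \<open>d > 0\<close> nz by (simp add: h_def)
  have near: "dist (x + s *\<^sub>R v + t *\<^sub>R w) x < d" if "0 \<le> s" "s \<le> h" "0 \<le> t" "t \<le> h" for s t
  proof -
    have "dist (x + s *\<^sub>R v + t *\<^sub>R w) x = norm (s *\<^sub>R v + t *\<^sub>R w)"
      by (simp add: dist_norm)
    also have "\<dots> \<le> s * norm v + t * norm w"
      using that by (intro norm_triangle_le) auto
    also have "\<dots> \<le> h * norm v + h * norm w"
      using that by (intro add_mono mult_right_mono) auto
    also have "\<dots> < h * (2 * (norm v + norm w + 1))"
      using \<open>h > 0\<close> nz by (simp add: algebra_simps add_strict_increasing)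
    also have "\<dots> = d" using nz by (simp add: h_def)
    finally show ?thesis .
  qed
  have inW: "x + s *\<^sub>R v + t *\<^sub>R w \<in> W" if "0 \<le> s" "s \<le> h" "0 \<le> t" "t \<le> h" for s t
    using near[OF that] d3 by (auto simp: d_def dist_commute)
  have inW': "x + s *\<^sub>R w + t *\<^sub>R v \<in> W" if "0 \<le> s" "s \<le> h" "0 \<le> t" "t \<le> h" for s t
    using inW[of t s] that by (simp add: algebra_simps)
  obtain s t where st: "s \<in> {0..h}" "t \<in> {0..h}"
    "f (x + h *\<^sub>R v + h *\<^sub>R w) - f (x + h *\<^sub>R v) - f (x + h *\<^sub>R w) + f x
      = h\<^sup>2 * Dv (x + s *\<^sub>R v + t *\<^sub>R w) w"
    using second_difference_mvt[OF \<open>h > 0\<close> f' v, OF inW inW] by blast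
  obtain s' t' where st': "s' \<in> {0..h}" "t' \<in> {0..h}"
    "f (x + h *\<^sub>R w + h *\<^sub>R v) - f (x + h *\<^sub>R w) - f (x + h *\<^sub>R v) + f x
      = h\<^sup>2 * Dw (x + s' *\<^sub>R w + t' *\<^sub>R v) v"
    using second_difference_mvt[OF \<open>h > 0\<close> f' w, OF inW' inW'] by blast
  have "h\<^sup>2 * Dv (x + s *\<^sub>R v + t *\<^sub>R w) w = h\<^sup>2 * Dw (x + t' *\<^sub>R v + s' *\<^sub>R w) v"
    using st(3) st'(3) by (simp add: algebra_simps)
  then have eq: "Dv (x + s *\<^sub>R v + t *\<^sub>R w) w = Dw (x + t' *\<^sub>R v + s' *\<^sub>R w) v"
    using \<open>h > 0\<close> by simp
  have "dist (Dv x w) (Dw x v) < e + e"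
    using 1[of "x + s *\<^sub>R v + t *\<^sub>R w"] 2[of "x + t' *\<^sub>R v + s' *\<^sub>R w"] near[of s t] near[of t' s'] st st' eq
    by (simp add: d_def dist_real_def)
  then show False by (simp add: e_def)
qed

section \<open>Derivative tests at an interior maximum\<close>

lemma local_max_derivatives:
  fixes g g' :: "real \<Rightarrow> real"
  assumes "d > 0"
    and g: "\<And>t. \<bar>t\<bar> < d \<Longrightarrow> (g has_real_derivative g' t) (at t)"
    and g': "(g' has_real_derivative g'') (at 0)"
    and max: "\<And>t. \<bar>t\<bar> < d \<Longrightarrow> g t \<le> g 0"
  shows "g' 0 = 0" "g'' \<le> 0"
proof -
  show "g' 0 = 0"
    using DERIV_local_max[OF g[of 0] \<open>d > 0\<close>] max \<open>d > 0\<close> by simp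
  show "g'' \<le> 0"
  proof (rule ccontr)
    \<comment> \<open>A positive \<open>g''\<close> makes \<open>g'\<close> positive just to the
      right of 0, and the mean value theorem then lifts \<open>g\<close> above
      \<open>g 0\<close>.\<close>
    assume "\<not> g'' \<le> 0"
    then obtain c where c: "c > 0" "\<And>h. 0 < h \<Longrightarrow> h < c \<Longrightarrow> g' 0 < g' (0 + h)"
      using DERIV_pos_inc_right[OF g'] by auto
    define h where "h = min c d / 2"
    have h: "0 < h" "h < c" "h < d" using c \<open>d > 0\<close> by (auto simp: h_def)
    obtain z where z: "0 < z" "z < h" "g h - g 0 = (h - 0) * g' z"
      using MVT2[of 0 h g g'] g h by (auto simp: less_imp_le)
    have "g' z > 0" using c(2)[of z] z h \<open>g' 0 = 0\<close> by simp
    then have "g h > g 0" using z h by (simp add: algebra_simps)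
    then show False using max[of h] h by simp
  qed
qed

text \<open>The symmetry of the Hessian is part of the definition: \<open>f12\<close> serves as both mixed derivatives.\<close>

definition has_jet2_on ::
  "(real^2 \<Rightarrow> real) \<Rightarrow> (real^2 \<Rightarrow> real) \<Rightarrow> (real^2 \<Rightarrow> real) \<Rightarrow> (real^2 \<Rightarrow> real) \<Rightarrow> (real^2 \<Rightarrow> real)
    \<Rightarrow> (real^2 \<Rightarrow> real) \<Rightarrow> (real^2) set \<Rightarrow> bool"
where
  "has_jet2_on f f1 f2 f11 f12 f22 W \<longleftrightarrow> (\<forall>x\<in>W.
     (f has_derivative (\<lambda>v. v$1 * f1 x + v$2 * f2 x)) (at x) \<and>
     (f1 has_derivative (\<lambda>v. v$1 * f11 x + v$2 * f12 x)) (at x) \<and>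
     (f2 has_derivative (\<lambda>v. v$1 * f12 x + v$2 * f22 x)) (at x))"

lemma has_jet2_on_subset: "has_jet2_on f f1 f2 f11 f12 f22 W \<Longrightarrow> V \<subseteq> W \<Longrightarrow> has_jet2_on f f1 f2 f11 f12 f22 V"
  by (auto simp: has_jet2_on_def)

lemma has_jet2_on_continuous_on:
  "has_jet2_on f f1 f2 f11 f12 f22 W \<Longrightarrow> continuous_on W f"
  by (auto simp: has_jet2_on_def intro!: continuous_at_imp_continuous_on has_derivative_continuous)

lemma jet2_at_local_max:
  fixes v :: "real^2"
  assumes jet: "has_jet2_on f f1 f2 f11 f12 f22 W" and "open W" "x \<in> W"
    and max: "\<And>y. y \<in> W \<Longrightarrow> f y \<le> f x"
  shows "f1 x = 0" "f2 x = 0"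
    "(v$1)\<^sup>2 * f11 x + 2 * (v$1 * v$2) * f12 x + (v$2)\<^sup>2 * f22 x \<le> 0"
proof -
  have *: "v$1 * f1 x + v$2 * f2 x = 0 \<and>
    (v$1)\<^sup>2 * f11 x + 2 * (v$1 * v$2) * f12 x + (v$2)\<^sup>2 * f22 x \<le> 0" for v :: "real^2"
  proof -
    obtain r where r: "r > 0" "ball x r \<subseteq> W" using assms openE by blast
    define d where "d = r / (norm v + 1)"
    have nv: "norm v + 1 > 0" by (smt (verit) norm_ge_zero)
    have "d > 0" using r nv by (simp add: d_def)
    have inW: "x + t *\<^sub>R v \<in> W" if "\<bar>t\<bar> < d" for t
    proof -
      have "\<bar>t\<bar> * norm v \<le> \<bar>t\<bar> * (norm v + 1)" by (simp add: algebra_simps)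
      also have "\<dots> < d * (norm v + 1)" using that nv by simp
      also have "\<dots> = r" using nv by (simp add: d_def)
      finally have "x + t *\<^sub>R v \<in> ball x r" by (simp add: dist_norm)
      then show ?thesis using r by auto
    qed
    have lin: "((\<lambda>t. x + t *\<^sub>R v) has_derivative (\<lambda>r. r *\<^sub>R v)) (at t)" for t
      by (auto intro!: derivative_eq_intros)
    define g where "g t = f (x + t *\<^sub>R v)" for t
    define g' where "g' t = v$1 * f1 (x + t *\<^sub>R v) + v$2 * f2 (x + t *\<^sub>R v)" for t
    have dg: "(g has_real_derivative g' t) (at t)" if "\<bar>t\<bar> < d" for t
    proof -
      have "(f has_derivative (\<lambda>w. w$1 * f1 (x + t *\<^sub>R v) + w$2 * f2 (x + t *\<^sub>R v))) (at (x + t *\<^sub>R v))"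
        using jet inW[OF that] by (auto simp: has_jet2_on_def)
      from has_derivative_compose[OF lin this] show ?thesis
        unfolding has_field_derivative_def g_def[abs_def]
        by (rule has_derivative_eq_rhs) (simp add: fun_eq_iff g'_def algebra_simps)
    qed
    have "(f1 has_derivative (\<lambda>w. w$1 * f11 x + w$2 * f12 x)) (at (x + 0 *\<^sub>R v))"
      "(f2 has_derivative (\<lambda>w. w$1 * f12 x + w$2 * f22 x)) (at (x + 0 *\<^sub>R v))"
      using jet \<open>x \<in> W\<close> by (auto simp: has_jet2_on_def)
    note d12 = has_derivative_compose[OF lin this(1)] has_derivative_compose[OF lin this(2)]
    have dg': "(g' has_real_derivative (v$1)\<^sup>2 * f11 x + 2 * (v$1 * v$2) * f12 x + (v$2)\<^sup>2 * f22 x) (at 0)"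
      unfolding has_field_derivative_def g'_def
      by (rule has_derivative_eq_rhs[OF has_derivative_add[OF
             has_derivative_mult_right[OF d12(1), of "v$1"] has_derivative_mult_right[OF d12(2), of "v$2"]]])
        (simp add: fun_eq_iff algebra_simps power2_eq_square)
    show ?thesis
      using local_max_derivatives[OF \<open>d > 0\<close> dg dg'] max inW by (simp add: g_def g'_def)
  qed
  show "f1 x = 0" using *[of "axis 1 1"] by (simp add: axis_def)
  show "f2 x = 0" using *[of "axis 2 1"] by (simp add: axis_def)
  show "(v$1)\<^sup>2 * f11 x + 2 * (v$1 * v$2) * f12 x + (v$2)\<^sup>2 * f22 x \<le> 0" using * by blast
qed

text \<open>Completing the square writes the operator as a nonnegative combination of the second
  derivatives in the directions (1, -b/a) and (0, 1), neither of which is positive at a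
  maximum.\<close>

lemma elliptic_at_local_max:
  assumes jet: "has_jet2_on f f1 f2 f11 f12 f22 W" and "open W" "x \<in> W"
    and max: "\<And>y. y \<in> W \<Longrightarrow> f y \<le> f x"
    and "a > (0::real)" "c > 0" "b\<^sup>2 < a * c"
  shows "a * f11 x - 2 * b * f12 x + c * f22 x \<le> 0"
proof -
  note H = jet2_at_local_max(3)[OF jet \<open>open W\<close> \<open>x \<in> W\<close> max]
  define t where "t = b / a"
  have Q: "f11 x - 2 * t * f12 x + t\<^sup>2 * f22 x \<le> 0" "f22 x \<le> 0"
    using H[of "vector [1, -t] :: real^2"] H[of "vector [0, 1] :: real^2"] by (simp_all add: algebra_simps)
  have "a * f11 x - 2 * b * f12 x + c * f22 x
      = a * (f11 x - 2 * t * f12 x + t\<^sup>2 * f22 x) + (a * c - b\<^sup>2) / a * f22 x"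
    using \<open>a > 0\<close> by (simp add: t_def field_simps power2_eq_square)
  also have "\<dots> \<le> 0"
    by (rule add_nonpos_nonpos; rule mult_nonneg_nonpos) (use Q assms in auto)
  finally show ?thesis .
qed


section \<open>Hopf's boundary point lemma and the strong maximum principle\<close>

definition annulus :: "'a::metric_space \<Rightarrow> real \<Rightarrow> real \<Rightarrow> 'a set" where
  "annulus y r R = {x. r \<le> dist y x \<and> dist y x \<le> R}"

lemma compact_annulus: "compact (annulus (y::'a::heine_borel) r R)"
proof -
  have "annulus y r R = cball y R - ball y r" by (auto simp: annulus_def)
  then show ?thesis by (simp add: compact_diff)
qed

lemma hopf_barrier_jet:
  fixes y :: "real^2" and k :: real
  defines "e \<equiv> \<lambda>x. exp (- k * (dist y x)\<^sup>2)"
  shows "has_jet2_on (\<lambda>x. e x - m)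
    (\<lambda>x. - 2 * k * (x$1 - y$1) * e x) (\<lambda>x. - 2 * k * (x$2 - y$2) * e x)
    (\<lambda>x. (4 * k\<^sup>2 * (x$1 - y$1)\<^sup>2 - 2 * k) * e x)
    (\<lambda>x. 4 * k\<^sup>2 * (x$1 - y$1) * (x$2 - y$2) * e x)
    (\<lambda>x. (4 * k\<^sup>2 * (x$2 - y$2)\<^sup>2 - 2 * k) * e x) UNIV"
proof -
  have e: "e = (\<lambda>x. exp (- k * ((x$1 - y$1)\<^sup>2 + (x$2 - y$2)\<^sup>2)))"
    by (simp add: e_def dist_vec_def L2_set_def UNIV_2 fun_eq_iff dist_real_def power2_commute)
  have nth: "((\<lambda>x. x $ i) has_derivative (\<lambda>v. v $ i)) (at x)" for i and x :: "real^2"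
    by (rule bounded_linear_imp_has_derivative[OF bounded_linear_vec_nth])
  have de: "(e has_derivative (\<lambda>v. v$1 * (- 2 * k * (x$1 - y$1) * e x) + v$2 * (- 2 * k * (x$2 - y$2) * e x))) (at x)" for x
    unfolding e by (auto intro!: derivative_eq_intros nth simp: fun_eq_iff algebra_simps)
  show ?thesis
    unfolding has_jet2_on_def
    by (auto intro!: derivative_eq_intros de nth simp: fun_eq_iff algebra_simps power2_eq_square)
qed

text \<open>Hopf's barrier \<open>h x = exp (- k |x - y|\<^sup>2) - exp (- k R\<^sup>2)\<close>: applying the operator to it gives a
  positive factor times \<open>2 k P - S\<close> below, so for large \<open>k\<close> it is a strict subsolution on the annulus, and
  \<open>f + \<epsilon> h\<close> has no interior maximum there.\<close>

lemma hopf_boundary_point: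
  fixes y z :: "real^2"
  assumes jet: "has_jet2_on f f1 f2 f11 f12 f22 W" and "open W" and ball: "cball y R \<subseteq> W" and "0 < R"
    and cont: "continuous_on (cball y R) a" "continuous_on (cball y R) b" "continuous_on (cball y R) c"
      "continuous_on (cball y R) b1" "continuous_on (cball y R) b2"
    and ell: "\<And>x. x \<in> cball y R \<Longrightarrow> a x > 0 \<and> c x > 0 \<and> (b x)\<^sup>2 < a x * c x"
    and pde: "\<And>x. x \<in> cball y R \<Longrightarrow> a x * f11 x - 2 * b x * f12 x + c x * f22 x = b1 x * f1 x + b2 x * f2 x"
    and neg: "\<And>x. x \<in> ball y R \<Longrightarrow> f x < 0" and nonpos: "\<And>x. x \<in> cball y R \<Longrightarrow> f x \<le> 0"
    and z: "dist y z = R" "f z = 0"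
  shows "f1 z \<noteq> 0 \<or> f2 z \<noteq> 0"
proof -
  \<comment> \<open>The inner disc is cut out because \<open>P\<close> vanishes at \<open>y\<close>,
    where the barrier has its maximum and cannot be a subsolution.\<close>
  define A where "A = annulus y (R/2) R"
  have A: "compact A" "A \<subseteq> cball y R"
    by (auto simp: A_def compact_annulus) (auto simp: annulus_def)
  have "z \<in> A" using z \<open>0 < R\<close> by (simp add: A_def annulus_def)
  define P where "P x = a x * (x$1 - y$1)\<^sup>2 - 2 * b x * ((x$1 - y$1) * (x$2 - y$2)) + c x * (x$2 - y$2)\<^sup>2" for x
  define S where "S x = a x + c x - b1 x * (x$1 - y$1) - b2 x * (x$2 - y$2)" for x
  have cA: "continuous_on A a" "continuous_on A b" "continuous_on A c" "continuous_on A b1" "continuous_on A b2"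
    using cont A continuous_on_subset by metis+
  have cP: "continuous_on A P" and cS: "continuous_on A S"
    unfolding P_def[abs_def] S_def[abs_def] by (intro continuous_intros cA)+
  have Ppos: "P x > 0" if "x \<in> A" for x
  proof -
    define p q where pq: "p = x$1 - y$1" "q = x$2 - y$2"
    have "x \<noteq> y" using that \<open>0 < R\<close> by (auto simp: A_def annulus_def)
    then have "p \<noteq> 0 \<or> q \<noteq> 0" by (auto simp: pq vec_eq_iff forall_2)
    have E: "a x > 0" "c x > 0" "(b x)\<^sup>2 < a x * c x" using ell that A by auto
    have "a x * P x = (a x * p - b x * q)\<^sup>2 + (a x * c x - (b x)\<^sup>2) * q\<^sup>2"
      unfolding P_def pq[symmetric] by (simp add: algebra_simps power2_eq_square)
    also have "\<dots> > 0"
    proof (cases "q = 0")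
      case True
      then show ?thesis using E \<open>p \<noteq> 0 \<or> q \<noteq> 0\<close> by simp
    next
      case False
      then show ?thesis using E by (intro add_nonneg_pos) auto
    qed
    finally show ?thesis using E by (simp add: zero_less_mult_iff)
  qed
  obtain l where l: "l > 0" "\<And>x. x \<in> A \<Longrightarrow> l \<le> P x"
    using continuous_attains_inf[OF A(1) _ cP] Ppos \<open>z \<in> A\<close> by (metis empty_iff)
  obtain M where M: "\<And>x. x \<in> A \<Longrightarrow> S x \<le> M"
    using continuous_attains_sup[OF A(1) _ cS] \<open>z \<in> A\<close> by (metis empty_iff)
  \<comment> \<open>With this choice \<open>2 * k * l\<close> is \<open>\<bar>M\<bar> + 1\<close>,
    which exceeds every value of \<open>S\<close> on the annulus.\<close>
  define k where "k = (\<bar>M\<bar> + 1) / (2 * l)"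
  have "k > 0" using l by (simp add: k_def)
  have kPS: "2 * k * P x > S x" if "x \<in> A" for x
  proof -
    have "S x < 2 * k * l" using M[OF that] l by (simp add: k_def)
    also have "\<dots> \<le> 2 * k * P x" using l(2)[OF that] \<open>k > 0\<close> by simp
    finally show ?thesis .
  qed
  define e where "e x = exp (- k * (dist y x)\<^sup>2)" for x
  define m where "m = exp (- k * R\<^sup>2)"
  define h where "h x = e x - m" for x
  define h1 where "h1 x = - 2 * k * (x$1 - y$1) * e x" for x
  define h2 where "h2 x = - 2 * k * (x$2 - y$2) * e x" for x
  define h11 where "h11 x = (4 * k\<^sup>2 * (x$1 - y$1)\<^sup>2 - 2 * k) * e x" for x
  define h12 where "h12 x = 4 * k\<^sup>2 * (x$1 - y$1) * (x$2 - y$2) * e x" for x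
  define h22 where "h22 x = (4 * k\<^sup>2 * (x$2 - y$2)\<^sup>2 - 2 * k) * e x" for x
  have hjet: "has_jet2_on h h1 h2 h11 h12 h22 UNIV"
    using hopf_barrier_jet[where y=y and k=k and m=m]
    by (simp add: h_def[abs_def] e_def[abs_def] h1_def[abs_def] h2_def[abs_def] h11_def[abs_def] h12_def[abs_def] h22_def[abs_def])
  have Lh: "a x * h11 x - 2 * b x * h12 x + c x * h22 x - b1 x * h1 x - b2 x * h2 x > 0" if "x \<in> A" for x
  proof -
    have "a x * h11 x - 2 * b x * h12 x + c x * h22 x - b1 x * h1 x - b2 x * h2 x
       = 2 * k * e x * (2 * k * P x - S x)"
      by (simp add: h11_def h12_def h22_def h1_def h2_def P_def S_def algebra_simps power2_eq_square)
    also have "\<dots> > 0" using kPS[OF that] \<open>k > 0\<close> by (simp add: e_def)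
    finally show ?thesis .
  qed
  have fcont: "continuous_on W f"
    using jet by (rule has_jet2_on_continuous_on)
  have hcont: "continuous_on UNIV h"
    using hjet by (rule has_jet2_on_continuous_on)
  have "cball y (R/2) \<noteq> {}" "cball y (R/2) \<subseteq> ball y R" using \<open>0 < R\<close> by auto
  moreover have "continuous_on (cball y (R/2)) f"
    using fcont ball calculation(2) by (meson continuous_on_subset order_trans ball_subset_cball)
  ultimately obtain x0 where x0: "x0 \<in> cball y (R/2)" "\<And>x. x \<in> cball y (R/2) \<Longrightarrow> f x \<le> f x0"
    using continuous_attains_sup[of "cball y (R/2)" f] by auto
  have "f x0 < 0" using x0 neg \<open>cball y (R/2) \<subseteq> ball y R\<close> by blast
  \<comment> \<open>Since \<open>h\<close> is at most 1, adding \<open>\<epsilon> * h\<close> uses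
    up at most half of the gap between \<open>f\<close> and 0 on the inner circle.\<close>
  define \<epsilon> where "\<epsilon> = - f x0 / 2"
  have "\<epsilon> > 0" using \<open>f x0 < 0\<close> by (simp add: \<epsilon>_def)
  have hle: "h x \<le> 1" for x
  proof -
    have "e x \<le> 1" using \<open>k > 0\<close> by (simp add: e_def)
    then show ?thesis by (simp add: h_def m_def add_increasing2 diff_le_eq)
  qed
  have hR: "h x = 0" if "dist y x = R" for x
    using that by (simp add: h_def e_def m_def)
  define w where "w x = f x + \<epsilon> * h x" for x
  have wjet: "has_jet2_on w (\<lambda>x. f1 x + \<epsilon> * h1 x) (\<lambda>x. f2 x + \<epsilon> * h2 x) (\<lambda>x. f11 x + \<epsilon> * h11 x)
      (\<lambda>x. f12 x + \<epsilon> * h12 x) (\<lambda>x. f22 x + \<epsilon> * h22 x) W"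
    using jet hjet unfolding has_jet2_on_def w_def[abs_def]
    by (auto intro!: derivative_eq_intros simp: fun_eq_iff algebra_simps)
  have "continuous_on A w"
    unfolding w_def[abs_def] using fcont hcont A ball
    by (intro continuous_intros) (auto intro: continuous_on_subset)
  then obtain xm where xm: "xm \<in> A" "\<And>x. x \<in> A \<Longrightarrow> w x \<le> w xm"
    using continuous_attains_sup[OF A(1)] \<open>z \<in> A\<close> by blast
  \<comment> \<open>A positive maximum cannot lie on the outer circle, where \<open>h\<close>
    vanishes, nor on the inner one, by the choice of \<open>\<epsilon>\<close>, nor between them,
    where the barrier is a strict subsolution.\<close>
  have "w xm \<le> 0"
  proof (rule ccontr)
    assume "\<not> w xm \<le> 0"
    have "dist y xm \<noteq> R"
      using \<open>\<not> w xm \<le> 0\<close> nonpos[of xm] xm(1) A hR[of xm] by (auto simp: w_def)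
    moreover have "dist y xm \<noteq> R/2"
    proof
      assume "dist y xm = R/2"
      then have "f xm \<le> f x0" using x0 by simp
      moreover have "\<epsilon> * h xm \<le> \<epsilon>" using hle[of xm] \<open>\<epsilon> > 0\<close> by simp
      ultimately show False using \<open>\<not> w xm \<le> 0\<close> \<open>f x0 < 0\<close> w_def[of xm] \<epsilon>_def by linarith
    qed
    ultimately have xmU: "xm \<in> ball y R - cball y (R/2)" using xm(1) by (auto simp: A_def annulus_def)
    define U where "U = ball y R - cball y (R/2)"
    have U: "open U" "U \<subseteq> A" "U \<subseteq> W" using A ball by (auto simp: U_def A_def annulus_def open_Diff)
    note wU = has_jet2_on_subset[OF wjet \<open>U \<subseteq> W\<close>]
    have xU: "xm \<in> U" using xmU by (simp add: U_def)
    have mx: "w x \<le> w xm" if "x \<in> U" for x using xm that U by auto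
    have D: "f1 xm + \<epsilon> * h1 xm = 0" "f2 xm + \<epsilon> * h2 xm = 0"
      using jet2_at_local_max(1,2)[OF wU \<open>open U\<close> xU mx] by auto
    have E: "a xm > 0" "c xm > 0" "(b xm)\<^sup>2 < a xm * c xm" using ell xm(1) A by auto
    have "a xm * (f11 xm + \<epsilon> * h11 xm) - 2 * b xm * (f12 xm + \<epsilon> * h12 xm) + c xm * (f22 xm + \<epsilon> * h22 xm) \<le> 0"
      using elliptic_at_local_max[OF wU \<open>open U\<close> xU mx E] by simp
    moreover have "a xm * f11 xm - 2 * b xm * f12 xm + c xm * f22 xm = b1 xm * f1 xm + b2 xm * f2 xm"
      using pde xm(1) A by auto
    ultimately have "b1 xm * f1 xm + b2 xm * f2 xm + \<epsilon> * (a xm * h11 xm - 2 * b xm * h12 xm + c xm * h22 xm) \<le> 0"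
      by (simp add: algebra_simps)
    \<comment> \<open>At a critical point of \<open>w\<close> the first order terms in the equation
      for \<open>f\<close> turn into those of \<open>- \<epsilon> * h\<close>, so the full operator
      applied to \<open>h\<close> appears.\<close>
    moreover have "f1 xm = - \<epsilon> * h1 xm" "f2 xm = - \<epsilon> * h2 xm" using D by auto
    ultimately have "\<epsilon> * (a xm * h11 xm - 2 * b xm * h12 xm + c xm * h22 xm - b1 xm * h1 xm - b2 xm * h2 xm) \<le> 0"
      by (simp add: algebra_simps)
    then show False using Lh[OF xm(1)] \<open>\<epsilon> > 0\<close> by (simp add: mult_le_0_iff)
  qed
  then have wle: "w x \<le> 0" if "x \<in> A" for x using xm(2)[OF that] by simp
  show ?thesis
  proof (rule ccontr)
    \<comment> \<open>If the gradient of \<open>f\<close> vanished at \<open>z\<close>, the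
      derivative of \<open>w\<close> towards the centre would be that of
      \<open>\<epsilon> * h\<close>, which is positive. Then \<open>w\<close> would exceed
      \<open>w z = 0\<close> inside the annulus.\<close>
    assume "\<not> ?thesis"
    then have f0: "f1 z = 0" "f2 z = 0" by auto
    have "z \<in> W" using z ball by auto
    have lin: "((\<lambda>t. z + t *\<^sub>R (y - z)) has_derivative (\<lambda>r. r *\<^sub>R (y - z))) (at 0)"
      by (auto intro!: derivative_eq_intros)
    have "(w has_derivative (\<lambda>v. v$1 * (f1 z + \<epsilon> * h1 z) + v$2 * (f2 z + \<epsilon> * h2 z))) (at (z + 0 *\<^sub>R (y - z)))"
      using wjet \<open>z \<in> W\<close> by (auto simp: has_jet2_on_def)
    from has_derivative_compose[OF lin this]
    have "((\<lambda>t. w (z + t *\<^sub>R (y - z))) has_real_derivative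
        \<epsilon> * ((y$1 - z$1) * h1 z + (y$2 - z$2) * h2 z)) (at 0)"
      unfolding has_field_derivative_def
      by (rule has_derivative_eq_rhs) (simp add: fun_eq_iff f0 algebra_simps)
    moreover have "\<epsilon> * ((y$1 - z$1) * h1 z + (y$2 - z$2) * h2 z) > 0"
    proof -
      have "y \<noteq> z" using z \<open>0 < R\<close> by auto
      then have "y$1 - z$1 \<noteq> 0 \<or> y$2 - z$2 \<noteq> 0" by (auto simp: vec_eq_iff forall_2)
      then have "(y$1 - z$1)\<^sup>2 + (y$2 - z$2)\<^sup>2 > 0" by (simp add: sum_power2_gt_zero_iff)
      moreover have "(y$1 - z$1) * h1 z + (y$2 - z$2) * h2 z = 2 * k * e z * ((y$1 - z$1)\<^sup>2 + (y$2 - z$2)\<^sup>2)"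
        by (simp add: h1_def h2_def algebra_simps power2_eq_square)
      ultimately show ?thesis using \<open>k > 0\<close> \<open>\<epsilon> > 0\<close> by (simp add: e_def)
    qed
    ultimately obtain d where d: "d > 0" "\<And>t. 0 < t \<Longrightarrow> t < d \<Longrightarrow> w z < w (z + t *\<^sub>R (y - z))"
      using DERIV_pos_inc_right by fastforce
    \<comment> \<open>The bound 1/2 keeps the point outside the inner disc.\<close>
    define t where "t = min d 1 / 2"
    have t: "0 < t" "t < d" "t \<le> 1/2" using d by (auto simp: t_def)
    have "y - (z + t *\<^sub>R (y - z)) = (1 - t) *\<^sub>R (y - z)" by (simp add: algebra_simps)
    then have "dist y (z + t *\<^sub>R (y - z)) = (1 - t) * R" using z t by (simp add: dist_norm)
    moreover have "(1 - t) * R \<le> R" "R / 2 \<le> (1 - t) * R" using t \<open>0 < R\<close> by (auto simp: field_simps)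
    ultimately have "z + t *\<^sub>R (y - z) \<in> A" by (simp add: A_def annulus_def)
    moreover have "w z = 0" using z hR by (simp add: w_def)
    ultimately show False using d(2)[OF t(1,2)] wle by fastforce
  qed
qed


text \<open>Around a point with \<open>f < 0\<close> close to the zero set, the largest ball free of
  zeros touches that set at a point inside \<open>V\<close>. Hopf's lemma gives a nonzero gradient
  there, but a zero of \<open>f\<close> is an interior maximum. Hence the zero set is open as well
  as closed.\<close>

lemma strong_maximum_principle:
  fixes u x :: "real^2"
  assumes jet: "has_jet2_on f f1 f2 f11 f12 f22 V" and V: "open V" "connected V"
    and cont: "continuous_on V a" "continuous_on V b" "continuous_on V c"
      "continuous_on V b1" "continuous_on V b2"
    and ell: "\<And>x. x \<in> V \<Longrightarrow> a x > 0 \<and> c x > 0 \<and> (b x)\<^sup>2 < a x * c x"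
    and pde: "\<And>x. x \<in> V \<Longrightarrow> a x * f11 x - 2 * b x * f12 x + c x * f22 x = b1 x * f1 x + b2 x * f2 x"
    and nonpos: "\<And>x. x \<in> V \<Longrightarrow> f x \<le> 0"
    and u: "u \<in> V" "f u = 0" and x: "x \<in> V"
  shows "f x = 0"
proof -
  define Z where "Z = {x \<in> V. f x = 0}"
  have fcont: "continuous_on V f" using jet by (rule has_jet2_on_continuous_on)
  have "closedin (top_of_set V) Z"
    unfolding Z_def using continuous_closedin_preimage_constant[OF fcont, of 0] by simp
  moreover have "open Z"
  proof (rule openI)
    fix z assume "z \<in> Z"
    then have z: "z \<in> V" "f z = 0" by (auto simp: Z_def)
    obtain r where r: "r > 0" "ball z r \<subseteq> V" using \<open>open V\<close> z openE by blast
    have "ball z (r/2) \<subseteq> Z"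
    proof
      fix y assume y: "y \<in> ball z (r/2)"
      have inV: "cball y R \<subseteq> V" if "R < r/2" for R
      proof
        fix p assume "p \<in> cball y R"
        then have "dist z p < r"
          using y that dist_triangle[of z p y] by (simp add: dist_commute)
        then show "p \<in> V" using r by auto
      qed
      have yV: "y \<in> V" using y r by (auto intro: subsetD)
      show "y \<in> Z"
      proof (rule ccontr)
        assume "y \<notin> Z"
        then have fy: "f y < 0" using nonpos yV by (force simp: Z_def less_le)
        have d: "dist y z < r/2" using y by (simp add: dist_commute)
        \<comment> \<open>The zeros no farther from \<open>y\<close> than \<open>z\<close> form a
          compact set, so there is a nearest one, and it bounds the ball for Hopf's lemma.\<close>
        define K where "K = {p \<in> cball y (dist y z). f p = 0}"
        have "continuous_on (cball y (dist y z)) f"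
          using fcont inV[OF d] continuous_on_subset by blast
        then have "closed K"
          unfolding K_def using continuous_closed_preimage_constant[of "cball y (dist y z)" f 0] by simp
        moreover have "bounded K" by (rule bounded_subset[OF bounded_cball]) (auto simp: K_def)
        ultimately have "compact K" by (simp add: compact_eq_bounded_closed)
        moreover have "z \<in> K" using z by (simp add: K_def)
        ultimately obtain z' where z': "z' \<in> K" "\<And>p. p \<in> K \<Longrightarrow> dist y z' \<le> dist y p"
          using distance_attains_inf[of K y] compact_imp_closed by blast
        define R where "R = dist y z'"
        have R: "R < r/2" "0 < R" "R \<le> dist y z"
          using z'(2)[OF \<open>z \<in> K\<close>] d fy z'(1) by (auto simp: R_def K_def)
        have sub: "cball y R \<subseteq> V" using inV R by blast
        have neg: "f p < 0" if "p \<in> ball y R" for p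
        proof -
          have "p \<notin> K" using z'(2)[of p] that by (force simp: R_def)
          then have "f p \<noteq> 0" using that R by (simp add: K_def)
          then show ?thesis using nonpos[of p] sub that by (force simp: less_le)
        qed
        have "f1 z' \<noteq> 0 \<or> f2 z' \<noteq> 0"
        proof (rule hopf_boundary_point[OF jet \<open>open V\<close> sub \<open>0 < R\<close>])
          show "continuous_on (cball y R) a" "continuous_on (cball y R) b" "continuous_on (cball y R) c"
            "continuous_on (cball y R) b1" "continuous_on (cball y R) b2"
            using cont sub continuous_on_subset by blast+
        qed (use sub ell pde neg nonpos z' in \<open>auto simp: R_def K_def\<close>)
        moreover have "z' \<in> V" "f z' = 0" using z' sub by (auto simp: K_def R_def)
        ultimately show False
          using jet2_at_local_max(1,2)[OF jet \<open>open V\<close>, of z'] nonpos by simp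
      qed
    qed
    then show "\<exists>e>0. ball z e \<subseteq> Z" using r by (intro exI[of _ "r/2"]) auto
  qed
  then have "openin (top_of_set V) Z" by (auto simp: openin_open Z_def)
  ultimately have "Z = {} \<or> Z = V" using V(2) by (auto simp: connected_clopen)
  then show ?thesis using u x by (auto simp: Z_def)
qed


text \<open>One zero in the open half disc \<open>V\<close> is enough, since \<open>V\<close> is
  convex and the interior principle then applies. If there were none, \<open>u\<close> would lie on
  the edge, and a disc in \<open>V\<close> tangent to the edge at \<open>u\<close> would give a
  nonzero gradient by Hopf's lemma, against \<open>crit\<close>.\<close>

lemma strong_maximum_principle_half_plane:
  fixes u :: "real^2"
  assumes jet: "has_jet2_on f f1 f2 f11 f12 f22 W" and "open W" and u: "u \<in> W \<inter> half_plane" "f u = 0"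
    and cont: "continuous_on (W \<inter> half_plane) a" "continuous_on (W \<inter> half_plane) b"
      "continuous_on (W \<inter> half_plane) c" "continuous_on (W \<inter> half_plane) b1"
      "continuous_on (W \<inter> half_plane) b2"
    and ell: "\<And>x. x \<in> W \<inter> half_plane \<Longrightarrow> a x > 0 \<and> c x > 0 \<and> (b x)\<^sup>2 < a x * c x"
    and pde: "\<And>x. x \<in> W \<inter> half_plane \<Longrightarrow>
      a x * f11 x - 2 * b x * f12 x + c x * f22 x = b1 x * f1 x + b2 x * f2 x"
    and nonpos: "\<And>x. x \<in> W \<inter> half_plane \<Longrightarrow> f x \<le> 0"
    and crit: "u$2 = 0 \<Longrightarrow> f1 u = 0 \<and> f2 u = 0"
  shows "\<exists>r>0. ball u r \<subseteq> W \<and> (\<forall>x \<in> ball u r \<inter> half_plane. f x = 0)"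
proof -
  obtain r where r: "r > 0" "ball u r \<subseteq> W" using \<open>open W\<close> u openE by blast
  define V where "V = ball u r \<inter> {x. 0 < x$2}"
  have V: "V \<subseteq> W \<inter> half_plane" using r by (auto simp: V_def half_plane_def)
  have oV: "open V" unfolding V_def by (intro open_Int open_ball open_Collect_less continuous_intros)
  have "convex {x::real^2. 0 < x$2}"
    using convex_halfspace_gt[of 0 "axis 2 1 :: real^2"] by (simp add: inner_axis' )
  then have cV: "connected V" unfolding V_def by (intro convex_connected convex_Int) auto
  have jetV: "has_jet2_on f f1 f2 f11 f12 f22 V" using has_jet2_on_subset[OF jet] V by blast
  have contV: "continuous_on V a" "continuous_on V b" "continuous_on V c" "continuous_on V b1" "continuous_on V b2"
    using cont V continuous_on_subset by blast+
  have "\<exists>z\<in>V. f z = 0"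
  proof (rule ccontr)
    assume no: "\<not> (\<exists>z\<in>V. f z = 0)"
    have "u \<notin> V" using no u by auto
    then have u2: "u$2 = 0" using u r by (auto simp: V_def half_plane_def)
    \<comment> \<open>The disc of radius \<open>R\<close> about \<open>u + axis 2 R\<close> touches
      the edge at \<open>u\<close> and stays within distance \<open>2 * R < r\<close> of
      \<open>u\<close>.\<close>
    define R where "R = r/3"
    define y where "y = u + axis 2 R"
    have "R > 0" using r by (simp add: R_def)
    have dyu: "dist y u = R" using \<open>R > 0\<close> by (simp add: y_def dist_norm norm_vec_def L2_set_def UNIV_2 axis_def)
    have ysub: "x \<in> ball u r \<and> x$2 \<ge> R - dist y x" if "dist y x \<le> R" for x
    proof
      have "dist u x \<le> R + R" using that dyu dist_triangle[of u x y] by (simp add: dist_commute)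
      then show "x \<in> ball u r" using \<open>R > 0\<close> by (simp add: R_def)
      have "\<bar>(y - x)$2\<bar> \<le> dist y x" unfolding dist_norm by (rule component_le_norm_cart)
      then show "x$2 \<ge> R - dist y x" using u2 by (simp add: y_def axis_def)
    qed
    have sub: "cball y R \<subseteq> W \<inter> half_plane"
    proof
      fix x assume "x \<in> cball y R"
      then show "x \<in> W \<inter> half_plane" using ysub[of x] r by (auto simp: half_plane_def)
    qed
    have "ball y R \<subseteq> V"
    proof
      fix x assume "x \<in> ball y R"
      then show "x \<in> V" using ysub[of x] by (auto simp: V_def)
    qed
    then have neg: "f x < 0" if "x \<in> ball y R" for x
      using no nonpos[of x] that V by (force simp: less_le)
    have "f1 u \<noteq> 0 \<or> f2 u \<noteq> 0"
    proof (rule hopf_boundary_point[OF jet \<open>open W\<close> _ \<open>0 < R\<close>])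
      show "continuous_on (cball y R) a" "continuous_on (cball y R) b" "continuous_on (cball y R) c"
        "continuous_on (cball y R) b1" "continuous_on (cball y R) b2"
        using cont sub continuous_on_subset by blast+
          show "cball y R \<subseteq> W" using sub by simp
    qed (fact neg dyu u ell[OF subsetD[OF sub]] pde[OF subsetD[OF sub]] nonpos[OF subsetD[OF sub]])+
    then show False using crit u2 by simp
  qed
  then obtain z where z: "z \<in> V" "f z = 0" by blast
  have fV: "f x = 0" if "x \<in> V" for x
    by (rule strong_maximum_principle[OF jetV oV cV contV _ _ _ z that]) (use ell[OF subsetD[OF V]] pde[OF subsetD[OF V]] nonpos[OF subsetD[OF V]] in \<open>simp_all only:\<close>)
  have "f x = 0" if x: "x \<in> ball u r \<inter> half_plane" for x
  proof (cases "x$2 > 0")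
    case True
    then show ?thesis using fV x by (auto simp: V_def)
  next
    case False
    then have x2: "x$2 = 0" using x by (auto simp: half_plane_def)
    \<comment> \<open>Values on the edge are limits of the zero values above it.\<close>
    have "((\<lambda>t. x + t *\<^sub>R axis 2 1) \<longlongrightarrow> x + 0 *\<^sub>R axis 2 1) (at_right (0::real))"
      by (intro tendsto_intros)
    then have lim: "((\<lambda>t. x + t *\<^sub>R axis 2 1) \<longlongrightarrow> x) (at_right (0::real))"
      by simp
    have "isCont f x"
      using has_jet2_on_continuous_on[OF jet] \<open>open W\<close> r x
      by (auto simp: continuous_on_eq_continuous_at)
    then have "((\<lambda>t. f (x + t *\<^sub>R axis 2 1)) \<longlongrightarrow> f x) (at_right (0::real))"
      using isCont_tendsto_compose lim by blast
    moreover have "eventually (\<lambda>t. x + t *\<^sub>R axis 2 1 \<in> ball u r) (at_right (0::real))"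
      using topological_tendstoD[OF lim open_ball] x by blast
    then have "eventually (\<lambda>t. f (x + t *\<^sub>R axis 2 1) = 0) (at_right (0::real))"
      using eventually_at_right_less[of "0::real"]
      by eventually_elim (use fV x2 in \<open>auto simp: V_def axis_def\<close>)
    then have "((\<lambda>t. f (x + t *\<^sub>R axis 2 1)) \<longlongrightarrow> 0) (at_right (0::real))"
      by (rule tendsto_eventually)
    ultimately show ?thesis
      using tendsto_unique[OF trivial_limit_at_right_real] by blast
  qed
  then show ?thesis using r by blast
qed

section \<open>Coordinate functions on minimal surfaces\<close>

lemma smooth_on_subset:
  assumes "smooth_on f W" "V \<subseteq> W"
  shows "smooth_on f V"
proof -
  have "times_differentiable_on n g V" if "times_differentiable_on n g W" for n and g :: "'a \<Rightarrow> 'b"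
    using that
  proof (induction n arbitrary: g)
    case 0
    then show ?case using assms(2) continuous_on_subset by auto
  next
    case (Suc n)
    then show ?case using assms(2) by (simp add: subset_iff)
  qed
  then show ?thesis using assms(1) unfolding smooth_on_def by blast
qed

lemma smooth_on_frechet_derivative:
  assumes "smooth_on f W"
  shows "smooth_on (\<lambda>x. frechet_derivative f (at x) v) W"
  unfolding smooth_on_def
proof
  fix n
  have "times_differentiable_on (Suc n) f W" using assms unfolding smooth_on_def by blast
  then show "times_differentiable_on n (\<lambda>x. frechet_derivative f (at x) v) W" by simp
qed

lemma smooth_on_has_derivative:
  assumes "smooth_on f W" "x \<in> W"
  shows "(f has_derivative frechet_derivative f (at x)) (at x)"
proof -
  have "times_differentiable_on (Suc 0) f W" using assms(1) unfolding smooth_on_def by blast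
  then have "f differentiable (at x)" using assms(2) by simp
  then show ?thesis by (simp only: frechet_derivative_works)
qed

lemma smooth_on_continuous_on:
  assumes "smooth_on f W"
  shows "continuous_on W f"
proof -
  have "times_differentiable_on 0 f W" using assms unfolding smooth_on_def by blast
  then show ?thesis by simp
qed

lemma smooth_on_partial: "smooth_on X W \<Longrightarrow> smooth_on (partial i X) W"
  using smooth_on_frechet_derivative[of X W "axis i 1"] by (simp add: partial_def[abs_def])

lemma real2_eq_axis: "(v::real^2) = v$1 *\<^sub>R axis 1 1 + v$2 *\<^sub>R axis 2 1"
  by (simp add: vec_eq_iff forall_2 axis_def)

lemma linear_real2:
  assumes "linear (A :: real^2 \<Rightarrow> 'a::real_vector)"
  shows "A v = v$1 *\<^sub>R A (axis 1 1) + v$2 *\<^sub>R A (axis 2 1)"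
proof -
  have "A v = A (v$1 *\<^sub>R axis 1 1 + v$2 *\<^sub>R axis 2 1)" by (rule arg_cong[OF real2_eq_axis])
  then show ?thesis by (simp only: linear_add[OF assms] linear_cmul[OF assms])
qed

lemma smooth_on_has_derivative_partial:
  assumes "smooth_on X W" "x \<in> W"
  shows "(X has_derivative (\<lambda>v. v$1 *\<^sub>R partial 1 X x + v$2 *\<^sub>R partial 2 X x)) (at x)"
proof -
  note d = smooth_on_has_derivative[OF assms]
  show ?thesis
  proof (rule has_derivative_eq_rhs[OF d], rule ext)
    fix v
    show "frechet_derivative X (at x) v = v$1 *\<^sub>R partial 1 X x + v$2 *\<^sub>R partial 2 X x"
      unfolding partial_def by (rule linear_real2[OF has_derivative_linear[OF d]])
  qed
qed

text \<open>Differentiating \<open>partial 1 X\<close> yields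
  \<open>partial 2 (partial 1 X)\<close>, while the jet, like \<open>second_form X u 1 2\<close>,
  uses the opposite order. Symmetry of second derivatives reconciles them.\<close>

lemma smooth_on_inner_jet2:
  assumes X: "smooth_on X W" and "open W"
  shows "has_jet2_on (\<lambda>u. X u \<bullet> n) (\<lambda>u. partial 1 X u \<bullet> n) (\<lambda>u. partial 2 X u \<bullet> n)
    (\<lambda>u. partial 1 (partial 1 X) u \<bullet> n) (\<lambda>u. partial 1 (partial 2 X) u \<bullet> n)
    (\<lambda>u. partial 2 (partial 2 X) u \<bullet> n) W"
proof -
  have D: "((\<lambda>u. Y u \<bullet> n) has_derivative (\<lambda>v. v$1 * (partial 1 Y x \<bullet> n) + v$2 * (partial 2 Y x \<bullet> n))) (at x)"
    if "smooth_on Y W" "x \<in> W" for Y x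
    using has_derivative_inner_left[OF smooth_on_has_derivative_partial[OF that], of n]
    by (simp add: inner_add_left)
  have cont: "continuous_on W (\<lambda>u. partial i (partial j X) u \<bullet> n)" for i j
    using X by (intro continuous_intros smooth_on_continuous_on smooth_on_partial)
  have sym: "partial 2 (partial 1 X) x \<bullet> n = partial 1 (partial 2 X) x \<bullet> n" if "x \<in> W" for x
    using second_derivative_symmetric[OF \<open>open W\<close> that D[OF X], of "axis 1 1"
        "\<lambda>x v. v$1 * (partial 1 (partial 1 X) x \<bullet> n) + v$2 * (partial 2 (partial 1 X) x \<bullet> n)" "axis 2 1"
        "\<lambda>x v. v$1 * (partial 1 (partial 2 X) x \<bullet> n) + v$2 * (partial 2 (partial 2 X) x \<bullet> n)"]
      D[OF smooth_on_partial[OF X]] cont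
    by (simp add: axis_def)
  show ?thesis
    unfolding has_jet2_on_def
  proof (intro ballI conjI)
    fix x assume x: "x \<in> W"
    show "((\<lambda>u. partial 1 X u \<bullet> n) has_derivative
        (\<lambda>v. v$1 * (partial 1 (partial 1 X) x \<bullet> n) + v$2 * (partial 1 (partial 2 X) x \<bullet> n))) (at x)"
      using D[OF smooth_on_partial[OF X, of 1] x] unfolding sym[OF x] .
  qed (fact D[OF X] D[OF smooth_on_partial[OF X, of 2]])+
qed

section \<open>The moving frame of a chart and the coordinate equation\<close>

lemma cross3_frame_expansion:
  fixes x y v :: "real^3"
  defines "n \<equiv> cross3 x y"
  shows "(n \<bullet> n) *\<^sub>R v =
    ((y \<bullet> y) * (v \<bullet> x) - (x \<bullet> y) * (v \<bullet> y)) *\<^sub>R x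
    + ((x \<bullet> x) * (v \<bullet> y) - (x \<bullet> y) * (v \<bullet> x)) *\<^sub>R y + (n \<bullet> v) *\<^sub>R n"
proof -
  \<comment> \<open>Two evaluations of this double product by Lagrange's identity give the expansion
    of \<open>v\<close> in the frame \<open>x\<close>, \<open>y\<close>, \<open>n\<close>. The
    coefficients are those of the inverse Gram matrix, with its determinant
    \<open>n \<bullet> n\<close> cleared.\<close>
  have 1: "cross3 n (cross3 v n) = (n \<bullet> n) *\<^sub>R v - (n \<bullet> v) *\<^sub>R n" by (simp add: Lagrange)
  have 2: "cross3 v n = (v \<bullet> y) *\<^sub>R x - (v \<bullet> x) *\<^sub>R y" by (simp add: n_def Lagrange)
  have 3: "cross3 n x = (x \<bullet> x) *\<^sub>R y - (x \<bullet> y) *\<^sub>R x"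
    by (subst cross_skew) (simp add: n_def Lagrange)
  have 4: "cross3 n y = (x \<bullet> y) *\<^sub>R y - (y \<bullet> y) *\<^sub>R x"
    by (subst cross_skew) (simp add: n_def Lagrange inner_commute)
  have "(n \<bullet> n) *\<^sub>R v - (n \<bullet> v) *\<^sub>R n = (v \<bullet> y) *\<^sub>R cross3 n x - (v \<bullet> x) *\<^sub>R cross3 n y"
    unfolding 1[symmetric] unfolding 2 by (simp only: Cross3.right_diff_distrib cross_mult_right)
  then show ?thesis unfolding 3 4 by (simp add: algebra_simps)
qed

text \<open>Injectivity of the derivative makes the two partial derivatives independent, so the
  first fundamental form is positive definite. This is the ellipticity of the coordinate
  equation.\<close>

lemma local_parametrization_frame:
  assumes "local_parametrization S W X" "u \<in> W \<inter> half_plane"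
  defines "E \<equiv> first_form X u 1 1" and "F \<equiv> first_form X u 1 2" and "G \<equiv> first_form X u 2 2"
    and "n \<equiv> cross3 (partial 1 X u) (partial 2 X u)"
  shows "n \<noteq> 0" "n \<bullet> n = E * G - F\<^sup>2" "E > 0" "G > 0" "F\<^sup>2 < E * G"
proof -
  define A where "A = frechet_derivative X (at u)"
  have "X differentiable (at u)"
    using assms(1,2) smooth_on_has_derivative unfolding local_parametrization_def differentiable_def by blast
  then have lin: "linear A" unfolding A_def by (rule linear_frechet_derivative)
  have inj: "inj A" using assms(1,2) by (auto simp: A_def local_parametrization_def)
  have A: "A (vector [s, t]) = s *\<^sub>R partial 1 X u + t *\<^sub>R partial 2 X u" for s t
    using linear_real2[OF lin, of "vector [s, t]"] by (simp only: partial_def A_def vector_2)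
  have indep: "s *\<^sub>R partial 1 X u + t *\<^sub>R partial 2 X u = 0 \<Longrightarrow> s = 0 \<and> t = 0" for s t
  proof -
    assume "s *\<^sub>R partial 1 X u + t *\<^sub>R partial 2 X u = 0"
    then have "A (vector [s, t]) = A 0" using A linear_0[OF lin] by simp
    then have "vector [s, t] = (0::real^2)" using inj by (simp add: inj_eq)
    then show ?thesis by (simp add: vec_eq_iff forall_2)
  qed
  show nn: "n \<bullet> n = E * G - F\<^sup>2"
    by (simp add: n_def E_def F_def G_def first_form_def dot_cross power2_eq_square inner_commute)
  have ne: "partial 1 X u \<noteq> 0" "partial 2 X u \<noteq> 0" using indep[of 1 0] indep[of 0 1] by auto
  then show "E > 0" "G > 0" by (simp_all add: E_def G_def first_form_def)
  show "n \<noteq> 0"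
  proof
    assume "n = 0"
    then have "cross3 (partial 1 X u) n = 0" by simp
    then have "F *\<^sub>R partial 1 X u + (- E) *\<^sub>R partial 2 X u = 0"
      by (simp add: n_def Lagrange F_def E_def first_form_def)
    from indep[OF this] \<open>E > 0\<close> show False by simp
  qed
  then show "F\<^sup>2 < E * G" using nn inner_gt_zero_iff[of n] by linarith
qed

text \<open>The Laplace equation for the coordinate function \<open>X \<bullet> w\<close> on a minimal surface, multiplied by
  the determinant of the metric: the second derivative part is tangential, so its normal component
  drops out of the frame expansion.\<close>

lemma minimal_coordinate_pde:
  assumes X: "local_parametrization S W X" and u: "u \<in> W \<inter> half_plane" and H: "mean_curvature X u = 0"
  defines "E \<equiv> first_form X u 1 1" and "F \<equiv> first_form X u 1 2" and "G \<equiv> first_form X u 2 2"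
  defines "V \<equiv> G *\<^sub>R partial 1 (partial 1 X) u - (2 * F) *\<^sub>R partial 1 (partial 2 X) u + E *\<^sub>R partial 2 (partial 2 X) u"
  shows "G * (partial 1 (partial 1 X) u \<bullet> w) - 2 * F * (partial 1 (partial 2 X) u \<bullet> w) + E * (partial 2 (partial 2 X) u \<bullet> w)
    = (G * (V \<bullet> partial 1 X u) - F * (V \<bullet> partial 2 X u)) / (E * G - F\<^sup>2) * (partial 1 X u \<bullet> w)
    + (E * (V \<bullet> partial 2 X u) - F * (V \<bullet> partial 1 X u)) / (E * G - F\<^sup>2) * (partial 2 X u \<bullet> w)"
proof -
  define n where "n = cross3 (partial 1 X u) (partial 2 X u)"
  define D where "D = E * G - F\<^sup>2"
  note fr = local_parametrization_frame[OF X u, folded E_def F_def G_def n_def]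
  have "D > 0" using fr by (simp add: D_def)
  \<comment> \<open>The denominator of the mean curvature is positive, so its numerator vanishes;
    that numerator is the normal component of \<open>V\<close>.\<close>
  have "second_form X u 1 1 * G - 2 * second_form X u 1 2 * F + second_form X u 2 2 * E = 0"
    using H \<open>D > 0\<close> by (simp add: mean_curvature_def D_def E_def F_def G_def)
  then have "V \<bullet> unit_normal X u = 0"
    by (simp add: V_def second_form_def inner_diff_left inner_add_left mult.commute mult.left_commute)
  then have "n \<bullet> V = 0" using fr(1)
    by (simp add: unit_normal_def n_def[symmetric] sgn_div_norm inner_commute)
  then have "D *\<^sub>R V = (G * (V \<bullet> partial 1 X u) - F * (V \<bullet> partial 2 X u)) *\<^sub>R partial 1 X u
     + (E * (V \<bullet> partial 2 X u) - F * (V \<bullet> partial 1 X u)) *\<^sub>R partial 2 X u"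
    using cross3_frame_expansion[of "partial 1 X u" "partial 2 X u" V] fr(2)
    by (simp add: n_def D_def E_def F_def G_def first_form_def)
  from arg_cong[OF this, of "\<lambda>x. x \<bullet> w"]
  have "D * (V \<bullet> w) = (G * (V \<bullet> partial 1 X u) - F * (V \<bullet> partial 2 X u)) * (partial 1 X u \<bullet> w)
     + (E * (V \<bullet> partial 2 X u) - F * (V \<bullet> partial 1 X u)) * (partial 2 X u \<bullet> w)"
    by (simp only: inner_add_left inner_scaleR_left)
  moreover have "y = p / D * q + r / D * s" if "D * y = p * q + r * s" for y p q r s :: real
    using that \<open>D > 0\<close> by (simp add: field_simps)
  ultimately have "V \<bullet> w = (G * (V \<bullet> partial 1 X u) - F * (V \<bullet> partial 2 X u)) / D * (partial 1 X u \<bullet> w)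
     + (E * (V \<bullet> partial 2 X u) - F * (V \<bullet> partial 1 X u)) / D * (partial 2 X u \<bullet> w)"
    by blast
  moreover have "V \<bullet> w = G * (partial 1 (partial 1 X) u \<bullet> w) - 2 * F * (partial 1 (partial 2 X) u \<bullet> w) + E * (partial 2 (partial 2 X) u \<bullet> w)"
    by (simp add: V_def inner_diff_left inner_add_left)
  ultimately show ?thesis by (simp add: D_def)
qed

section \<open>Tangent planes and contact with the torus\<close>

text \<open>\<open>n\<close> is orthogonal to the tangent cone of \<open>S\<close> at \<open>p\<close>. This makes no reference to a parametrization,
  and is the way to see that one chart already determines the normal space.\<close>

definition flat_at :: "'a::real_inner set \<Rightarrow> 'a \<Rightarrow> 'a \<Rightarrow> bool" where
  "flat_at S p n \<longleftrightarrow> (\<forall>\<epsilon>>0. \<exists>\<delta>>0. \<forall>q\<in>S. dist q p < \<delta> \<longrightarrow> \<bar>n \<bullet> (q - p)\<bar> \<le> \<epsilon> * norm (q - p))"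

text \<open>This supplies normals of the torus from its defining function, without constructing a
  chart of the torus.\<close>

lemma flat_at_level_set:
  assumes "(f has_derivative (\<lambda>v. n \<bullet> v)) (at p)" and const: "\<And>q. q \<in> S \<Longrightarrow> f q = f p"
  shows "flat_at S p n"
  unfolding flat_at_def
proof (intro allI impI)
  fix \<epsilon> :: real assume "\<epsilon> > 0"
  then obtain d where "d > 0" and d: "\<And>q. norm (q - p) < d \<Longrightarrow> norm (f q - f p - n \<bullet> (q - p)) \<le> \<epsilon> * norm (q - p)"
    using assms(1) unfolding has_derivative_at_alt by blast
  have "\<bar>n \<bullet> (q - p)\<bar> \<le> \<epsilon> * norm (q - p)" if "q \<in> S" "dist q p < d" for q
    using d[of q] const[OF that(1)] that(2) by (simp add: dist_norm)
  then show "\<exists>\<delta>>0. \<forall>q\<in>S. dist q p < \<delta> \<longrightarrow> \<bar>n \<bullet> (q - p)\<bar> \<le> \<epsilon> * norm (q - p)"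
    using \<open>d > 0\<close> by blast
qed

lemma small_multiple_imp_zero:
  fixes x c :: real
  assumes "c \<ge> 0" and "\<And>\<epsilon>. \<epsilon> > 0 \<Longrightarrow> \<bar>x\<bar> \<le> \<epsilon> * c"
  shows "x = 0"
proof -
  have "\<bar>x\<bar> \<le> 0 + e" if "e > 0" for e
  proof -
    have "\<bar>x\<bar> \<le> e / (c + 1) * c" using assms(1) that by (intro assms(2)) simp
    also have "\<dots> \<le> e" using that \<open>c \<ge> 0\<close> by (simp add: field_simps)
    finally show ?thesis by simp
  qed
  then show ?thesis using field_le_epsilon[of "\<bar>x\<bar>" 0] by simp
qed

text \<open>The derivative is one-sided because at an edge point of a chart a curve may run into the
  surface without continuing backwards.\<close>

lemma flat_at_curve_derivative:
  assumes flat: "flat_at S p n" and c: "(c has_vector_derivative c') (at_right 0)" and "c 0 = p"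
    and S: "eventually (\<lambda>t. c t \<in> S) (at_right (0::real))"
  shows "n \<bullet> c' = 0"
proof -
  have lim: "((\<lambda>t. (c t - p) /\<^sub>R t) \<longlongrightarrow> c') (at_right 0)"
  proof (rule Lim_transform_eventually)
    have "((\<lambda>t. (1 / norm (t - 0)) *\<^sub>R (c t - (c 0 + (t - 0) *\<^sub>R c'))) \<longlongrightarrow> 0) (at_right 0)"
      using c unfolding has_vector_derivative_def has_derivative_within by blast
    then show "((\<lambda>t. (1 / norm t) *\<^sub>R (c t - (p + t *\<^sub>R c')) + c') \<longlongrightarrow> c') (at_right 0)"
      using tendsto_add[OF _ tendsto_const[of c']] \<open>c 0 = p\<close> by fastforce
    show "eventually (\<lambda>t. (1 / norm t) *\<^sub>R (c t - (p + t *\<^sub>R c')) + c' = (c t - p) /\<^sub>R t) (at_right 0)"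
      using eventually_at_right_less[of "0::real"]
      by eventually_elim (simp add: algebra_simps divide_inverse)
  qed
  have cont: "(c \<longlongrightarrow> p) (at_right 0)"
    using has_vector_derivative_continuous[OF c] \<open>c 0 = p\<close> by (simp add: continuous_within)
  have "\<bar>n \<bullet> c'\<bar> \<le> \<epsilon> * norm c'" if "\<epsilon> > 0" for \<epsilon>
  proof (rule tendsto_le[OF trivial_limit_at_right_real])
    show "((\<lambda>t. \<bar>n \<bullet> ((c t - p) /\<^sub>R t)\<bar>) \<longlongrightarrow> \<bar>n \<bullet> c'\<bar>) (at_right 0)"
      "((\<lambda>t. \<epsilon> * norm ((c t - p) /\<^sub>R t)) \<longlongrightarrow> \<epsilon> * norm c') (at_right 0)"
      by (intro tendsto_intros lim)+
    obtain \<delta> where "\<delta> > 0" and \<delta>: "\<And>q. q \<in> S \<Longrightarrow> dist q p < \<delta> \<Longrightarrow> \<bar>n \<bullet> (q - p)\<bar> \<le> \<epsilon> * norm (q - p)"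
      using flat \<open>\<epsilon> > 0\<close> unfolding flat_at_def by blast
    have "eventually (\<lambda>t. dist (c t) p < \<delta>) (at_right 0)"
      using cont \<open>\<delta> > 0\<close> by (rule tendstoD)
    then show "eventually (\<lambda>t. \<bar>n \<bullet> ((c t - p) /\<^sub>R t)\<bar> \<le> \<epsilon> * norm ((c t - p) /\<^sub>R t)) (at_right 0)"
      using S eventually_at_right_less[of "0::real"]
    proof eventually_elim
      case (elim t)
      have "inverse t * \<bar>n \<bullet> (c t - p)\<bar> \<le> inverse t * (\<epsilon> * norm (c t - p))"
        using \<delta> elim by (intro mult_left_mono) auto
      then show ?case using elim(3) by (simp add: abs_mult mult.left_commute)
    qed
  qed
  then show ?thesis
    using small_multiple_imp_zero[of "norm c'" "n \<bullet> c'"] by simp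
qed

lemma half_plane_curve:
  assumes "open W" "u \<in> W \<inter> half_plane" "v$2 \<ge> 0"
  shows "eventually (\<lambda>t. u + t *\<^sub>R v \<in> W \<inter> half_plane) (at_right (0::real))"
proof -
  have "((\<lambda>t. u + t *\<^sub>R v) \<longlongrightarrow> u + 0 *\<^sub>R v) (at_right (0::real))"
    by (intro tendsto_intros)
  then have "eventually (\<lambda>t. u + t *\<^sub>R v \<in> W) (at_right (0::real))"
    using topological_tendstoD assms by fastforce
  then show ?thesis
    using eventually_at_right_less[of "0::real"]
    by eventually_elim (use assms in \<open>auto simp: half_plane_def\<close>)
qed

lemma smooth_on_curve:
  assumes "smooth_on X W" "u \<in> W"
  shows "((\<lambda>t. X (u + t *\<^sub>R v)) has_vector_derivative frechet_derivative X (at u) v) (at 0 within T)"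
proof -
  have lin: "((\<lambda>t. u + t *\<^sub>R v) has_derivative (\<lambda>r. r *\<^sub>R v)) (at 0 within T)"
    by (auto intro!: derivative_eq_intros)
  note d = smooth_on_has_derivative[OF assms]
  have "(X has_derivative frechet_derivative X (at u)) (at (u + 0 *\<^sub>R v))"
    using d by simp
  from has_derivative_compose[OF lin this] show ?thesis
    unfolding has_vector_derivative_def
    by (rule has_derivative_eq_rhs)
      (simp add: fun_eq_iff linear_cmul[OF has_derivative_linear[OF d]])
qed

text \<open>Directions pointing into the half plane give curves in \<open>S\<close>, and they
  include both coordinate vectors, which span the plane. Linearity settles the remaining
  directions.\<close>

lemma flat_at_imp_normal:
  assumes "flat_at S p n"
  shows "n \<in> normal_space S p"
  unfolding normal_space_def
proof (clarsimp simp: tangent_space_def orthogonal_def)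
  fix W X u v assume X: "local_parametrization S W X" and u: "u \<in> W" "u \<in> half_plane" and p: "p = X u"
  have "open W" "smooth_on X W" using X by (auto simp: local_parametrization_def)
  have *: "n \<bullet> frechet_derivative X (at u) v = 0" if "v$2 \<ge> 0" for v
  proof (rule flat_at_curve_derivative[OF assms smooth_on_curve[OF \<open>smooth_on X W\<close> \<open>u \<in> W\<close>]])
    have "X ` (W \<inter> half_plane) \<subseteq> S" using X by (auto simp: local_parametrization_def dest: openin_imp_subset)
    then show "eventually (\<lambda>t. X (u + t *\<^sub>R v) \<in> S) (at_right 0)"
      using half_plane_curve[OF \<open>open W\<close>, of u v] u that by (auto elim!: eventually_mono)
  qed (simp add: p)
  have lin: "linear (frechet_derivative X (at u))"
    using smooth_on_has_derivative[OF \<open>smooth_on X W\<close> \<open>u \<in> W\<close>] by (rule has_derivative_linear)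
  show "n \<bullet> frechet_derivative X (at u) v = 0"
    using *[of "axis 1 1"] *[of "axis 2 1"] linear_real2[OF lin, of v]
    by (simp add: axis_def inner_add_right)
qed

text \<open>Points of \<open>S\<close> close to \<open>X u\<close> come from parameters close to
  \<open>u\<close>, because the chart image is relatively open and the inverse chart is continuous.
  Injectivity of the derivative bounds the parameter distance by the distance in space, so the first
  order error of \<open>X\<close> is small against the latter.\<close>

lemma flat_at_parametrization:
  assumes X: "local_parametrization S W X" and u: "u \<in> W \<inter> half_plane"
    and n: "n \<bullet> partial 1 X u = 0" "n \<bullet> partial 2 X u = 0"
  shows "flat_at S (X u) n"
  unfolding flat_at_def
proof (intro allI impI)
  fix \<epsilon> :: real assume "\<epsilon> > 0"
  define A where "A = frechet_derivative X (at u)"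
  have "smooth_on X W" and inj: "inj A" and ope: "openin (top_of_set S) (X ` (W \<inter> half_plane))"
    using X u by (auto simp: local_parametrization_def A_def)
  obtain Y where Y: "homeomorphism (W \<inter> half_plane) (X ` (W \<inter> half_plane)) X Y"
    using X by (auto simp: local_parametrization_def)
  have dX: "(X has_derivative A) (at u)"
    unfolding A_def using \<open>smooth_on X W\<close> u by (intro smooth_on_has_derivative) auto
  then have lin: "linear A" by (rule has_derivative_linear)
  have nA: "n \<bullet> A v = 0" for v
    using linear_real2[OF lin, of v] n by (simp add: A_def partial_def inner_add_right)
  obtain B where "B > 0" and B: "\<And>v. B * norm v \<le> norm (A v)"
    using linear_inj_bounded_below_pos[OF lin inj] by blast
  \<comment> \<open>The first bound lets half of the lower estimate \<open>B\<close> absorb the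
    error; the second makes the error times \<open>norm n + 1\<close> at most
    \<open>\<epsilon> * B / 2\<close> times the parameter distance.\<close>
  define \<eta> where "\<eta> = min (B/2) (\<epsilon> * B / 2 / (norm n + 1))"
  have nn: "norm n + 1 > 0" by (smt (verit) norm_ge_zero)
  have \<eta>: "\<eta> \<le> B/2" "\<eta> \<le> \<epsilon> * B / 2 / (norm n + 1)" by (simp_all only: \<eta>_def min.cobounded1 min.cobounded2)
  have "\<eta> > 0" using \<open>B > 0\<close> \<open>\<epsilon> > 0\<close> nn by (simp add: \<eta>_def)
  then obtain d where "d > 0" and d: "\<And>w. norm (w - u) < d \<Longrightarrow> norm (X w - X u - A (w - u)) \<le> \<eta> * norm (w - u)"
    using dX unfolding has_derivative_at_alt by blast
  have "continuous_on (X ` (W \<inter> half_plane)) Y" using Y by (simp add: homeomorphism_def)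
  moreover have "X u \<in> X ` (W \<inter> half_plane)" using u by blast
  ultimately obtain d1 where "d1 > 0" and d1: "\<And>q. q \<in> X ` (W \<inter> half_plane) \<Longrightarrow> dist q (X u) < d1 \<Longrightarrow> dist (Y q) (Y (X u)) < d"
    using \<open>d > 0\<close> unfolding continuous_on_iff by metis
  obtain d2 where "d2 > 0" and d2: "\<And>q. q \<in> S \<Longrightarrow> dist q (X u) < d2 \<Longrightarrow> q \<in> X ` (W \<inter> half_plane)"
    using ope u unfolding openin_euclidean_subtopology_iff by (metis imageI)
  have "\<bar>n \<bullet> (q - X u)\<bar> \<le> \<epsilon> * norm (q - X u)" if "q \<in> S" "dist q (X u) < min d1 d2" for q
  proof -
    have qX: "q \<in> X ` (W \<inter> half_plane)" using d2 that by simp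
    define w where "w = Y q"
    have w: "X w = q" using qX Y by (auto simp: w_def homeomorphism_def)
    have "Y (X u) = u" using Y u by (auto simp: homeomorphism_def)
    then have "norm (w - u) < d" using d1[OF qX] that by (simp add: w_def dist_norm)
    note dw = d[OF this]
    have "B * norm (w - u) \<le> norm (A (w - u))" by (rule B)
    also have "\<dots> \<le> norm (X w - X u) + norm (X w - X u - A (w - u))"
      using norm_triangle_ineq4[of "X w - X u" "X w - X u - A (w - u)"] by simp
    also have "\<dots> \<le> norm (X w - X u) + B/2 * norm (w - u)"
      using dw \<eta>(1) mult_right_mono[of \<eta> "B/2" "norm (w - u)"] norm_ge_zero[of "w - u"] by linarith
    finally have wu: "B/2 * norm (w - u) \<le> norm (q - X u)" by (simp add: w)
    have "\<bar>n \<bullet> (q - X u)\<bar> = \<bar>n \<bullet> (X w - X u - A (w - u))\<bar>"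
      by (simp add: w inner_diff_right nA)
    also have "\<dots> \<le> norm n * norm (X w - X u - A (w - u))" by (rule Cauchy_Schwarz_ineq2)
    also have "\<dots> \<le> (norm n + 1) * (\<eta> * norm (w - u))" using dw by (intro mult_mono) auto
    also have "\<dots> \<le> (norm n + 1) * (\<epsilon> * B / 2 / (norm n + 1) * norm (w - u))"
      using nn \<eta>(2) by (intro mult_left_mono mult_right_mono) auto
    also have "\<dots> = \<epsilon> * (B/2 * norm (w - u))"
      using nn by (metis (no_types, opaque_lifting) less_irrefl mult.assoc mult.left_commute nonzero_eq_divide_eq times_divide_eq_right)
    also have "\<dots> \<le> \<epsilon> * norm (q - X u)" using wu \<open>\<epsilon> > 0\<close> by (intro mult_left_mono) auto
    finally show ?thesis .
  qed
  then show "\<exists>\<delta>>0. \<forall>q\<in>S. dist q (X u) < \<delta> \<longrightarrow> \<bar>n \<bullet> (q - X u)\<bar> \<le> \<epsilon> * norm (q - X u)"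
    using \<open>d1 > 0\<close> \<open>d2 > 0\<close> by (intro exI[of _ "min d1 d2"]) auto
qed

section \<open>One-sided contact of a minimal surface with a plane\<close>

lemma local_parametrization_image_openin:
  assumes X: "local_parametrization S W X" and "open V"
  shows "openin (top_of_set S) (X ` (W \<inter> half_plane \<inter> V))"
proof -
  obtain Y where Y: "homeomorphism (W \<inter> half_plane) (X ` (W \<inter> half_plane)) X Y"
    and ope: "openin (top_of_set S) (X ` (W \<inter> half_plane))"
    using X by (auto simp: local_parametrization_def)
  have "openin (top_of_set (W \<inter> half_plane)) (W \<inter> half_plane \<inter> V)"
    using \<open>open V\<close> by (rule openin_open_Int)
  then show ?thesis using homeomorphism_imp_open_map[OF Y] ope openin_trans by blast
qed

lemma local_parametrization_subset:
  "local_parametrization S W X \<Longrightarrow> X ` (W \<inter> half_plane) \<subseteq> S"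
  by (auto simp: local_parametrization_def dest: openin_imp_subset)

lemma minimal_surface_touching_plane:
  fixes w :: "real^3"
  assumes X: "local_parametrization S W X" and H: "\<And>u. u \<in> W \<inter> half_plane \<Longrightarrow> mean_curvature X u = 0"
    and u: "u \<in> W \<inter> half_plane" and T: "open T" "X u \<in> T"
    and side: "\<And>q. q \<in> S \<inter> T \<Longrightarrow> q \<bullet> w \<le> 0" and p: "X u \<bullet> w = 0"
    and crit: "u$2 = 0 \<Longrightarrow> partial 1 X u \<bullet> w = 0 \<and> partial 2 X u \<bullet> w = 0"
  shows "\<exists>T'. open T' \<and> X u \<in> T' \<and> (\<forall>q \<in> S \<inter> T'. q \<bullet> w = 0)"
proof -
  have "open W" and sm: "smooth_on X W" using X by (auto simp: local_parametrization_def)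
  \<comment> \<open>Shrinking the domain makes the one-sided bound hold on the whole chart.\<close>
  define V where "V = W \<inter> X -` T"
  have "open V"
    unfolding V_def using continuous_open_preimage[OF smooth_on_continuous_on[OF sm] \<open>open W\<close> \<open>open T\<close>] .
  have VW: "V \<inter> half_plane \<subseteq> W \<inter> half_plane" and "V \<subseteq> W" by (auto simp: V_def)
  have smV: "smooth_on X V" using smooth_on_subset[OF sm \<open>V \<subseteq> W\<close>] .
  define E where "E u = first_form X u 1 1" for u
  define F where "F u = first_form X u 1 2" for u
  define G where "G u = first_form X u 2 2" for u
  define v where "v u = G u *\<^sub>R partial 1 (partial 1 X) u - (2 * F u) *\<^sub>R partial 1 (partial 2 X) u
    + E u *\<^sub>R partial 2 (partial 2 X) u" for u
  define b1 where "b1 u = (G u * (v u \<bullet> partial 1 X u) - F u * (v u \<bullet> partial 2 X u)) / (E u * G u - (F u)\<^sup>2)" for u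
  define b2 where "b2 u = (E u * (v u \<bullet> partial 2 X u) - F u * (v u \<bullet> partial 1 X u)) / (E u * G u - (F u)\<^sup>2)" for u
  note frame = local_parametrization_frame[OF X, folded E_def F_def G_def]
  have c1: "continuous_on (V \<inter> half_plane) (partial i X)" for i
    using smooth_on_continuous_on[OF smooth_on_partial[OF smV]] continuous_on_subset by blast
  have c2: "continuous_on (V \<inter> half_plane) (partial i (partial j X))" for i j
    using smooth_on_continuous_on[OF smooth_on_partial[OF smooth_on_partial[OF smV]]] continuous_on_subset by blast
  have cE: "continuous_on (V \<inter> half_plane) E" "continuous_on (V \<inter> half_plane) F" "continuous_on (V \<inter> half_plane) G"
    unfolding E_def[abs_def] F_def[abs_def] G_def[abs_def] first_form_def by (intro continuous_intros c1)+
  have cv: "continuous_on (V \<inter> half_plane) v"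
    unfolding v_def[abs_def] by (intro continuous_intros cE c2)
  have nz: "E x * G x - (F x)\<^sup>2 \<noteq> 0" if "x \<in> V \<inter> half_plane" for x
    using frame(5)[of x] that VW by auto
  have cb: "continuous_on (V \<inter> half_plane) b1" "continuous_on (V \<inter> half_plane) b2"
    unfolding b1_def[abs_def] b2_def[abs_def] by (intro continuous_intros cE cv c1 ballI nz; assumption)+
  have XS: "X x \<in> S \<inter> T" if "x \<in> V \<inter> half_plane" for x
    using that local_parametrization_subset[OF X] by (auto simp: V_def)
  have "\<exists>r>0. ball u r \<subseteq> V \<and> (\<forall>x \<in> ball u r \<inter> half_plane. X x \<bullet> w = 0)"
  \<comment> \<open>The coefficients a, b, c of the operator are \<open>G\<close>, \<open>F\<close>,
    \<open>E\<close>, in this order, so its discriminant is that of the metric.\<close>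
  proof (rule strong_maximum_principle_half_plane[OF smooth_on_inner_jet2[OF smV \<open>open V\<close>] \<open>open V\<close> _ p
        cE(3) cE(2) cE(1) cb _ _ _ crit])
    show "u \<in> V \<inter> half_plane" using u T by (simp add: V_def)
    fix x assume x: "x \<in> V \<inter> half_plane"
    then have xW: "x \<in> W \<inter> half_plane" using VW by blast
    show "G x > 0 \<and> E x > 0 \<and> (F x)\<^sup>2 < G x * E x"
      using frame(3-5)[OF xW] by (simp add: mult.commute)
    show "X x \<bullet> w \<le> 0" using side XS[OF x] by blast
    show "G x * (partial 1 (partial 1 X) x \<bullet> w) - 2 * F x * (partial 1 (partial 2 X) x \<bullet> w) +
         E x * (partial 2 (partial 2 X) x \<bullet> w) = b1 x * (partial 1 X x \<bullet> w) + b2 x * (partial 2 X x \<bullet> w)"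
      using minimal_coordinate_pde[OF X xW H[OF xW], of w]
      unfolding b1_def b2_def v_def E_def F_def G_def .
  qed
  then obtain r where "r > 0" and r: "\<And>x. x \<in> ball u r \<inter> half_plane \<Longrightarrow> X x \<bullet> w = 0" by blast
  obtain T' where "open T'" and T': "X ` (W \<inter> half_plane \<inter> ball u r) = S \<inter> T'"
    using local_parametrization_image_openin[OF X open_ball] unfolding openin_open by blast
  have "X u \<in> S \<inter> T'" unfolding T'[symmetric] using u \<open>r > 0\<close> by simp
  moreover have "q \<bullet> w = 0" if "q \<in> S \<inter> T'" for q
    using that r unfolding T'[symmetric] by blast
  ultimately show ?thesis using \<open>open T'\<close> by blast
qed

section \<open>The toroid\<close>

definition axis_distance :: "real^3 \<Rightarrow> real" where
  "axis_distance x = sqrt ((x$1)\<^sup>2 + (x$2)\<^sup>2)"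

definition toroid_function :: "real \<Rightarrow> real^3 \<Rightarrow> real" where
  "toroid_function \<rho> x = (axis_distance x - \<rho>)\<^sup>2 + (x$3)\<^sup>2"

text \<open>Away from the axis of rotation this is the gradient of
  \<open>toroid_function \<rho>\<close>, not normalized.\<close>

definition toroid_normal :: "real \<Rightarrow> real^3 \<Rightarrow> real^3" where
  "toroid_normal \<rho> x = vector [2 * (axis_distance x - \<rho>) * x$1 / axis_distance x,
     2 * (axis_distance x - \<rho>) * x$2 / axis_distance x, 2 * x$3]"

lemma toroid_eq: "toroid \<rho> = {x. toroid_function \<rho> x \<le> 1}"
  by (simp add: toroid_def toroid_function_def axis_distance_def)

lemma axis_distance_pos:
  assumes "\<rho> > 1" "x \<in> toroid \<rho>"
  shows "axis_distance x > 0"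
proof -
  have "(axis_distance x - \<rho>)\<^sup>2 \<le> 1"
    using assms(2) zero_le_power2[of "x$3"] unfolding toroid_eq toroid_function_def mem_Collect_eq by linarith
  then have "\<bar>axis_distance x - \<rho>\<bar> \<le> 1" by (simp add: abs_square_le_1)
  then show ?thesis using assms(1) by linarith
qed

lemma continuous_toroid_function: "continuous_on UNIV (toroid_function \<rho>)"
  unfolding toroid_function_def[abs_def] axis_distance_def by (intro continuous_intros)

lemma frontier_toroid:
  assumes "x \<in> frontier (toroid \<rho>)"
  shows "toroid_function \<rho> x = 1" "x \<in> toroid \<rho>"
proof -
  have "closed (toroid \<rho>)"
    unfolding toroid_eq by (intro closed_Collect_le continuous_toroid_function continuous_on_const)
  then show "x \<in> toroid \<rho>" using assms by (simp add: frontier_def)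
  then have le: "toroid_function \<rho> x \<le> 1" by (simp add: toroid_eq)
  have "open {x. toroid_function \<rho> x < 1}"
    by (intro open_Collect_less continuous_toroid_function continuous_on_const)
  then have "{x. toroid_function \<rho> x < 1} \<subseteq> interior (toroid \<rho>)"
    by (intro interior_maximal) (auto simp: toroid_eq)
  then have "\<not> toroid_function \<rho> x < 1" using assms by (auto simp: frontier_def)
  then show "toroid_function \<rho> x = 1" using le by simp
qed

lemma has_derivative_toroid_function:
  assumes "axis_distance x > 0"
  shows "(toroid_function \<rho> has_derivative (\<lambda>v. toroid_normal \<rho> x \<bullet> v)) (at x)"
proof -
  have nth: "((\<lambda>x. x $ i) has_derivative (\<lambda>v. v $ i)) (at x)" for i and x :: "real^3"
    by (rule bounded_linear_imp_has_derivative[OF bounded_linear_vec_nth])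
  have pos: "(x$1)\<^sup>2 + (x$2)\<^sup>2 > 0" using assms by (simp add: axis_distance_def)
  have dist: "(axis_distance has_derivative (\<lambda>v. (x$1 * v$1 + x$2 * v$2) / axis_distance x)) (at x)"
    unfolding axis_distance_def[abs_def] using pos
    by (auto intro!: derivative_eq_intros nth simp: fun_eq_iff divide_simps)
  show ?thesis
    unfolding toroid_function_def[abs_def] toroid_normal_def inner_vec_def sum_3 using assms
    by (auto intro!: derivative_eq_intros dist nth simp: fun_eq_iff field_simps)
qed

lemma toroid_normal_nonzero:
  assumes "axis_distance x > 0" "toroid_function \<rho> x = 1"
  shows "toroid_normal \<rho> x \<noteq> 0"
proof
  assume "toroid_normal \<rho> x = 0"
  then have z: "(axis_distance x - \<rho>) * x$1 = 0" "(axis_distance x - \<rho>) * x$2 = 0" "x$3 = 0"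
    using assms(1) by (simp_all add: toroid_normal_def vec_eq_iff forall_3)
  have "x$1 \<noteq> 0 \<or> x$2 \<noteq> 0" using assms(1) by (auto simp: axis_distance_def)
  then have "axis_distance x - \<rho> = 0" using z by auto
  then show False using assms(2) z by (simp add: toroid_function_def)
qed

text \<open>The horizontal part of the normal is a multiple of the horizontal part of
  \<open>x\<close>. Geometrically, planes through the axis meet the torus orthogonally.\<close>

lemma toroid_normal_in_meridian_plane:
  assumes "w$3 = 0" "x \<bullet> w = 0"
  shows "toroid_normal \<rho> x \<bullet> w = 0"
proof -
  have "toroid_normal \<rho> x \<bullet> w = 2 * (axis_distance x - \<rho>) / axis_distance x * (x \<bullet> w)"
    using assms(1) by (simp add: toroid_normal_def inner_vec_def sum_3 distrib_left)
  then show ?thesis using assms(2) by simp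
qed

text \<open>The conormal of the surface is the normal of the torus, which lies in the meridian plane; so
  the free boundary condition is a homogeneous Neumann condition for \<open>X \<bullet> w\<close>.\<close>

lemma free_boundary_critical:
  fixes w :: "real^3"
  assumes "\<rho> > 1" and S: "embedded_free_boundary_minimal_surface (toroid \<rho>) S"
    and X: "local_parametrization S W X" and u: "u \<in> W" "u$2 = 0"
    and w: "w$3 = 0" "X u \<bullet> w = 0" and T: "open T" "X u \<in> T"
    and side: "\<And>q. q \<in> S \<inter> T \<Longrightarrow> q \<bullet> w \<le> 0"
  shows "partial 1 X u \<bullet> w = 0 \<and> partial 2 X u \<bullet> w = 0"
proof -
  have "open W" and sm: "smooth_on X W" using X by (auto simp: local_parametrization_def)
  have u': "u \<in> W \<inter> half_plane" using u by (simp add: half_plane_def)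
  have bd: "X x \<in> frontier (toroid \<rho>)" if "x \<in> W" "x$2 = 0" for x
  proof -
    have "X x \<in> surface_boundary S" using that X by (auto simp: surface_boundary_def)
    then show ?thesis using S by (auto simp: embedded_free_boundary_minimal_surface_def)
  qed
  define N where "N = toroid_normal \<rho> (X u)"
  have F: "toroid_function \<rho> (X u) = 1" and "X u \<in> toroid \<rho>"
    using frontier_toroid[OF bd[OF u]] by auto
  then have pos: "axis_distance (X u) > 0" using axis_distance_pos \<open>\<rho> > 1\<close> by blast
  have "N \<noteq> 0" unfolding N_def using toroid_normal_nonzero[OF pos F] .
  have flat: "flat_at (frontier (toroid \<rho>)) (X u) N"
    unfolding N_def using flat_at_level_set[OF has_derivative_toroid_function[OF pos]] frontier_toroid(1) F by metis
  \<comment> \<open>The edge of the chart is mapped into the torus, so its velocity is tangent to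
    the torus.\<close>
  have N1: "N \<bullet> partial 1 X u = 0"
    unfolding partial_def
  proof (rule flat_at_curve_derivative[OF flat smooth_on_curve[OF sm u(1)]])
    have "eventually (\<lambda>t. u + t *\<^sub>R axis 1 1 \<in> W \<inter> half_plane) (at_right (0::real))"
      by (rule half_plane_curve[OF \<open>open W\<close> u']) (simp add: axis_def)
    then show "eventually (\<lambda>t. X (u + t *\<^sub>R axis 1 1) \<in> frontier (toroid \<rho>)) (at_right 0)"
      by eventually_elim (use u in \<open>auto intro!: bd simp: axis_def\<close>)
  qed simp
  define n where "n = cross3 (partial 1 X u) (partial 2 X u)"
  note frame = local_parametrization_frame[OF X u', folded n_def]
  have "flat_at S (X u) n"
    by (rule flat_at_parametrization[OF X u']) (simp_all add: n_def dot_cross_self)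
  moreover have "meet_orthogonally_at S (frontier (toroid \<rho>)) (X u)"
  proof -
    have "X u \<in> surface_boundary S" using X u by (auto simp: surface_boundary_def)
    then show ?thesis using S by (auto simp: embedded_free_boundary_minimal_surface_def)
  qed
  ultimately have "n \<bullet> N = 0"
    using flat flat_at_imp_normal unfolding meet_orthogonally_at_def orthogonal_def by blast
  then have exp: "(n \<bullet> n) *\<^sub>R N = (- (partial 1 X u \<bullet> partial 2 X u) * (N \<bullet> partial 2 X u)) *\<^sub>R partial 1 X u
      + ((partial 1 X u \<bullet> partial 1 X u) * (N \<bullet> partial 2 X u)) *\<^sub>R partial 2 X u"
    using cross3_frame_expansion[of "partial 1 X u" "partial 2 X u" N] N1 by (simp add: n_def)
  have "n \<bullet> n \<noteq> 0" using frame(1) by simp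
  \<comment> \<open>By orthogonality \<open>N\<close> is tangent to the surface; being nonzero and
    orthogonal to \<open>partial 1 X u\<close>, it must have a component along
    \<open>partial 2 X u\<close>.\<close>
  then have N2: "N \<bullet> partial 2 X u \<noteq> 0" using exp \<open>N \<noteq> 0\<close> by auto
  define V where "V = W \<inter> X -` T"
  have "open V"
    unfolding V_def using continuous_open_preimage[OF smooth_on_continuous_on[OF sm] \<open>open W\<close> \<open>open T\<close>] .
  moreover have "u \<in> V" using u T by (simp add: V_def)
  ultimately obtain d where "d > 0" and d: "ball u d \<subseteq> V" using openE by blast
  \<comment> \<open>Along the edge both signs of \<open>t\<close> are admissible, so the maximum at
    0 is two-sided. In the direction of the second coordinate it would give only an
    inequality.\<close>
  have 1: "partial 1 X u \<bullet> w = 0"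
  proof (rule DERIV_local_max[where f = "\<lambda>t. X (u + t *\<^sub>R axis 1 1) \<bullet> w" and x = 0, OF _ \<open>d > 0\<close>])
    have "((\<lambda>t. X (u + t *\<^sub>R axis 1 1)) has_vector_derivative partial 1 X u) (at 0)"
      unfolding partial_def by (rule smooth_on_curve[OF sm u(1)])
    then show "((\<lambda>t. X (u + t *\<^sub>R axis 1 1) \<bullet> w) has_real_derivative partial 1 X u \<bullet> w) (at 0)"
      unfolding has_vector_derivative_def has_field_derivative_def
      by (auto dest!: has_derivative_inner_left[of _ _ _ w] simp: mult.commute[of _ "_ \<bullet> w"] elim!: has_derivative_eq_rhs)
    show "\<forall>t. \<bar>0 - t\<bar> < d \<longrightarrow> X (u + t *\<^sub>R axis 1 1) \<bullet> w \<le> X (u + 0 *\<^sub>R axis 1 1) \<bullet> w"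
    proof (intro allI impI)
      fix t :: real assume "\<bar>0 - t\<bar> < d"
      then have "u + t *\<^sub>R axis 1 1 \<in> V" using d by (auto simp: dist_norm intro!: subsetD[OF d])
      moreover have "u + t *\<^sub>R axis 1 1 \<in> half_plane" using u by (simp add: half_plane_def axis_def)
      ultimately have "X (u + t *\<^sub>R axis 1 1) \<in> S \<inter> T"
        using local_parametrization_subset[OF X] by (auto simp: V_def)
      then show "X (u + t *\<^sub>R axis 1 1) \<bullet> w \<le> X (u + 0 *\<^sub>R axis 1 1) \<bullet> w" using side w(2) by simp
    qed
  qed
  have "N \<bullet> w = 0" unfolding N_def using toroid_normal_in_meridian_plane w by blast
  \<comment> \<open>Pairing the expansion of \<open>N\<close> with \<open>w\<close> removes
    everything but a nonzero multiple of \<open>partial 2 X u \<bullet> w\<close>.\<close>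
  then have "((partial 1 X u \<bullet> partial 1 X u) * (N \<bullet> partial 2 X u)) * (partial 2 X u \<bullet> w) = 0"
    using arg_cong[OF exp, of "\<lambda>x. x \<bullet> w"] 1 by (simp add: inner_add_left inner_diff_left)
  moreover have "partial 1 X u \<bullet> partial 1 X u > 0" using frame(3) by (simp add: first_form_def)
  ultimately show ?thesis using 1 N2 by simp
qed

section \<open>Confinement to one meridian half plane\<close>

lemma free_boundary_disc_in_meridian_plane:
  assumes "\<rho> > 1" and "embedded_free_boundary_minimal_disc (toroid \<rho>) S"
  obtains \<theta> where "\<And>x. x \<in> S \<Longrightarrow> x$1 = axis_distance x * cos \<theta> \<and> x$2 = axis_distance x * sin \<theta>"
proof -
  have S: "embedded_free_boundary_minimal_surface (toroid \<rho>) S" and hom: "S homeomorphic (cball 0 1 :: (real^2) set)"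
    using assms(2) by (auto simp: embedded_free_boundary_minimal_disc_def)
  have "compact S" "S \<subseteq> toroid \<rho>" and minimal: "minimal_surface S"
    using S by (auto simp: embedded_free_boundary_minimal_surface_def)
  have "contractible S"
    using homeomorphic_contractible[OF _ homeomorphic_sym[THEN iffD1, OF hom]] convex_imp_contractible convex_cball by blast
  have "connected S" using homeomorphic_connectedness[OF hom] convex_connected convex_cball by blast
  have "S \<noteq> {}" using hom homeomorphic_empty by fastforce
  have pos: "axis_distance x > 0" if "x \<in> S" for x
    using axis_distance_pos[OF \<open>\<rho> > 1\<close>] that \<open>S \<subseteq> toroid \<rho>\<close> by blast
  have cC: "continuous_on S (\<lambda>x. Complex (x$1) (x$2))" by (intro continuous_intros)
  have nz: "Complex (x$1) (x$2) \<noteq> 0" if "x \<in> S" for x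
    using pos[OF that] by (auto simp: axis_distance_def complex_eq_iff)
  \<comment> \<open>The lifted angle is the imaginary part of a continuous logarithm of the
    horizontal coordinates, which never vanish together on the toroid.\<close>
  obtain g where g: "continuous_on S g" and exp: "\<And>x. x \<in> S \<Longrightarrow> Complex (x$1) (x$2) = exp (g x)"
    using continuous_logarithm_on_contractible[OF cC \<open>contractible S\<close> nz] by blast
  define \<phi> where "\<phi> x = Im (g x)" for x
  have cont: "continuous_on S \<phi>" unfolding \<phi>_def by (intro continuous_intros g)
  have polar: "x$1 = axis_distance x * cos (\<phi> x) \<and> x$2 = axis_distance x * sin (\<phi> x)" if "x \<in> S" for x
  proof -
    have "axis_distance x = cmod (Complex (x$1) (x$2))" by (simp add: axis_distance_def cmod_def)
    also have "\<dots> = exp (Re (g x))" by (simp add: exp[OF that])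
    finally have "axis_distance x = exp (Re (g x))" .
    then show ?thesis
      using arg_cong[OF exp[OF that], of Re] arg_cong[OF exp[OF that], of Im] by (simp add: \<phi>_def Re_exp Im_exp)
  qed
  obtain p0 where p0: "p0 \<in> S" and max: "\<And>x. x \<in> S \<Longrightarrow> \<phi> x \<le> \<phi> p0"
    using continuous_attains_sup[OF \<open>compact S\<close> \<open>S \<noteq> {}\<close> cont] by blast
  define w :: "real^3" where "w = vector [- sin (\<phi> p0), cos (\<phi> p0), 0]"
  have xw: "x \<bullet> w = axis_distance x * sin (\<phi> x - \<phi> p0)" if "x \<in> S" for x
  proof -
    have "x \<bullet> w = - sin (\<phi> p0) * x$1 + cos (\<phi> p0) * x$2" by (simp add: w_def inner_vec_def sum_3)
    then show ?thesis using polar[OF that] by (simp add: sin_diff algebra_simps)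
  qed
  define A where "A = {x \<in> S. \<phi> x = \<phi> p0}"
  have "closedin (top_of_set S) A"
    unfolding A_def using continuous_closedin_preimage_constant[OF cont, of "\<phi> p0"] by simp
  moreover have "openin (top_of_set S) A"
  proof (subst openin_subopen, intro ballI)
    fix p assume "p \<in> A"
    then have p: "p \<in> S" "\<phi> p = \<phi> p0" by (auto simp: A_def)
    \<comment> \<open>Within \<open>pi\<close> of the maximal angle the sine has the sign of its
      argument and vanishes only at 0; this excludes the opposite half of the plane.\<close>
    obtain T where "open T" and T: "S \<inter> \<phi> -` {\<phi> p0 - pi<..<\<phi> p0 + pi} = S \<inter> T"
      using continuous_openin_preimage_gen[OF cont open_greaterThanLessThan] unfolding openin_open by blast
    have near: "- pi < \<phi> q - \<phi> p0 \<and> \<phi> q - \<phi> p0 \<le> 0" if "q \<in> S \<inter> T" for q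
      using that max[of q] unfolding T[symmetric] by auto
    have side: "q \<bullet> w \<le> 0" if "q \<in> S \<inter> T" for q
    proof -
      have "sin (\<phi> q - \<phi> p0) \<le> 0" using sin_ge_zero[of "\<phi> p0 - \<phi> q"] near[OF that] sin_minus[of "\<phi> p0 - \<phi> q"] by simp
      then show ?thesis using xw[of q] pos[of q] that by (simp add: mult_nonneg_nonpos)
    qed
    obtain W X where X: "local_parametrization S W X" and "p \<in> X ` (W \<inter> half_plane)"
      using minimal p unfolding minimal_surface_def embedded_surface_def by blast
    then obtain u where u: "u \<in> W \<inter> half_plane" and pu: "p = X u" by blast
    have "p \<in> S \<inter> T" unfolding T[symmetric] using p by simp
    then have "X u \<in> T" by (simp add: pu)
    have Xw: "X u \<bullet> w = 0" using xw[OF p(1)] p(2) by (simp add: pu)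
    have H: "mean_curvature X x = 0" if "x \<in> W \<inter> half_plane" for x
      using minimal X that unfolding minimal_surface_def by blast
    have "\<exists>T'. open T' \<and> X u \<in> T' \<and> (\<forall>q\<in>S \<inter> T'. q \<bullet> w = 0)"
    proof (rule minimal_surface_touching_plane[OF X H u \<open>open T\<close> \<open>X u \<in> T\<close> side Xw])
      assume "u$2 = 0"
      have "u \<in> W" "w$3 = 0" using u by (auto simp: w_def)
      show "partial 1 X u \<bullet> w = 0 \<and> partial 2 X u \<bullet> w = 0"
        by (rule free_boundary_critical[OF \<open>\<rho> > 1\<close> S X \<open>u \<in> W\<close> \<open>u$2 = 0\<close> \<open>w$3 = 0\<close> Xw \<open>open T\<close> \<open>X u \<in> T\<close> side])
    qed
    then obtain T' where "open T'" "X u \<in> T'" and T': "\<And>q. q \<in> S \<inter> T' \<Longrightarrow> q \<bullet> w = 0" by blast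
    have "S \<inter> (T \<inter> T') \<subseteq> A"
    proof
      fix q assume q: "q \<in> S \<inter> (T \<inter> T')"
      then have "sin (\<phi> q - \<phi> p0) = 0" using T'[of q] xw[of q] pos[of q] by simp
      then have "\<phi> q - \<phi> p0 = 0" using sin_eq_0_pi[of "\<phi> q - \<phi> p0"] near[of q] q pi_gt_zero by auto
      then show "q \<in> A" using q by (simp add: A_def)
    qed
    moreover have "openin (top_of_set S) (S \<inter> (T \<inter> T'))"
      using \<open>open T\<close> \<open>open T'\<close> by (intro openin_open_Int open_Int)
    moreover have "p \<in> S \<inter> (T \<inter> T')" using p \<open>X u \<in> T\<close> \<open>X u \<in> T'\<close> by (simp add: pu)
    ultimately show "\<exists>B. openin (top_of_set S) B \<and> p \<in> B \<and> B \<subseteq> A" by blast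
  qed
  ultimately have "A = {} \<or> A = S" using \<open>connected S\<close> by (auto simp: connected_clopen)
  then have "A = S" using p0 by (auto simp: A_def)
  then have const: "\<phi> x = \<phi> p0" if "x \<in> S" for x using that by (auto simp: A_def)
  show ?thesis
    \<comment> \<open>Since \<open>axis_distance\<close> is positive on \<open>S\<close>, these
      equations describe a half plane. They exclude the opposite slice of the toroid, which lies in
      the same plane.\<close>
    by (rule that[of "\<phi> p0"]) (use polar const in force)
qed

section \<open>The planar slice\<close>

definition meridian_embedding :: "real \<Rightarrow> real^2 \<Rightarrow> real^3" where
  "meridian_embedding \<theta> s = s$1 *\<^sub>R vector [cos \<theta>, sin \<theta>, 0] + s$2 *\<^sub>R axis 3 1"

text \<open>A left inverse of \<open>meridian_embedding \<theta>\<close>, defined on all of space so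
  that its continuity is immediate.\<close>

definition meridian_projection :: "real \<Rightarrow> real^3 \<Rightarrow> real^2" where
  "meridian_projection \<theta> x = (x$1 * cos \<theta> + x$2 * sin \<theta>) *\<^sub>R axis 1 1 + x$3 *\<^sub>R axis 2 1"

lemma mem_cball_real2:
  "s \<in> cball (vector [\<rho>, 0] :: real^2) 1 \<longleftrightarrow> (s$1 - \<rho>)\<^sup>2 + (s$2)\<^sup>2 \<le> 1"
  by (simp add: dist_vec_def L2_set_def UNIV_2 dist_real_def power2_commute)

lemma mem_ball_real2:
  "s \<in> ball (vector [\<rho>, 0] :: real^2) 1 \<longleftrightarrow> (s$1 - \<rho>)\<^sup>2 + (s$2)\<^sup>2 < 1"
  by (simp add: dist_vec_def L2_set_def UNIV_2 dist_real_def power2_commute)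

lemma rotated_vertical_slice:
  "rotation_x3 \<theta> ` vertical_slice \<rho> = meridian_embedding \<theta> ` cball (vector [\<rho>, 0]) 1"
proof -
  have 1: "vertical_slice \<rho> = (\<lambda>s. vector [s$1, 0, s$2]) ` cball (vector [\<rho>, 0] :: real^2) 1"
  proof (intro equalityI subsetI)
    fix x assume "x \<in> vertical_slice \<rho>"
    then obtain a b where "x = vector [\<rho> + a, 0, b]" "a\<^sup>2 + b\<^sup>2 \<le> 1" by (auto simp: vertical_slice_def)
    then show "x \<in> (\<lambda>s. vector [s$1, 0, s$2]) ` cball (vector [\<rho>, 0] :: real^2) 1"
      by (intro image_eqI[of _ _ "vector [\<rho> + a, b]"]) (simp_all add: mem_cball_real2 del: mem_cball)
  next
    fix x :: "real^3" assume "x \<in> (\<lambda>s. vector [s$1, 0, s$2]) ` cball (vector [\<rho>, 0] :: real^2) 1"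
    then obtain s where "s \<in> cball (vector [\<rho>, 0] :: real^2) 1" "x = vector [s$1, 0, s$2]" by blast
    then show "x \<in> vertical_slice \<rho>"
      unfolding vertical_slice_def mem_cball_real2 by (intro CollectI exI[of _ "s$1 - \<rho>"] exI[of _ "s$2"]) simp
  qed
  show ?thesis
    unfolding 1 image_image
    by (intro image_cong)
      (simp_all add: rotation_x3_def meridian_embedding_def vec_eq_iff forall_3 axis_def mult.commute)
qed

theorem corollary4p2:
  fixes \<rho> :: real and \<Sigma> :: "(real^3) set"
  assumes "\<rho> > 2"
    and "embedded_free_boundary_minimal_disc (toroid \<rho>) \<Sigma>"
  shows "\<exists>\<theta>. \<Sigma> = rotation_x3 \<theta> ` vertical_slice \<rho>"
proof -
  have "\<rho> > 1" using \<open>\<rho> > 2\<close> by simp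
  obtain \<theta> where polar: "\<And>x. x \<in> \<Sigma> \<Longrightarrow> x$1 = axis_distance x * cos \<theta> \<and> x$2 = axis_distance x * sin \<theta>"
    using free_boundary_disc_in_meridian_plane[OF \<open>\<rho> > 1\<close> assms(2)] by blast
  have S: "embedded_free_boundary_minimal_surface (toroid \<rho>) \<Sigma>" and hom: "\<Sigma> homeomorphic (cball 0 1 :: (real^2) set)"
    using assms(2) by (auto simp: embedded_free_boundary_minimal_disc_def)
  have "compact \<Sigma>" "\<Sigma> \<subseteq> toroid \<rho>" and emb: "embedded_surface \<Sigma>" and bd: "surface_boundary \<Sigma> \<subseteq> frontier (toroid \<rho>)"
    using S by (auto simp: embedded_free_boundary_minimal_surface_def minimal_surface_def)
  have "\<Sigma> \<noteq> {}" using hom homeomorphic_empty by fastforce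
  define P where "P = meridian_projection \<theta>"
  define \<Phi> where "\<Phi> = meridian_embedding \<theta>"
  define c :: "real^2" where "c = vector [\<rho>, 0]"
  have contP: "continuous_on A P" for A
    unfolding P_def meridian_projection_def by (intro continuous_intros)
  have Px: "(P x)$1 = axis_distance x" "(P x)$2 = x$3" if "x \<in> \<Sigma>" for x
  proof -
    have "(P x)$1 = axis_distance x * ((cos \<theta>)\<^sup>2 + (sin \<theta>)\<^sup>2)"
      using polar[OF that] unfolding P_def meridian_projection_def distrib_left power2_eq_square
      by (simp add: axis_def)
    then show "(P x)$1 = axis_distance x" by simp
    show "(P x)$2 = x$3" by (simp add: P_def meridian_projection_def axis_def)
  qed
  have \<Phi>P: "\<Phi> (P x) = x" if "x \<in> \<Sigma>" for x
    using Px[OF that] polar[OF that] by (simp add: \<Phi>_def meridian_embedding_def vec_eq_iff forall_3 axis_def)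
  have level: "(P x$1 - \<rho>)\<^sup>2 + (P x$2)\<^sup>2 = toroid_function \<rho> x" if "x \<in> \<Sigma>" for x
    using Px[OF that] by (simp add: toroid_function_def)
  define K where "K = P ` \<Sigma>"
  have "\<Sigma> = \<Phi> ` K" unfolding K_def image_image using \<Phi>P by simp
  have "compact K" unfolding K_def by (rule compact_continuous_image[OF contP \<open>compact \<Sigma>\<close>])
  have "K \<subseteq> cball c 1"
    using level \<open>\<Sigma> \<subseteq> toroid \<rho>\<close> unfolding K_def c_def toroid_eq by (auto simp: mem_cball_real2 simp del: mem_cball)
  \<comment> \<open>Away from the edge of its domain a chart followed by \<open>P\<close> is a
    continuous injection between planes, so invariance of domain makes its image open. Injectivity
    holds because \<open>\<Phi>\<close> undoes \<open>P\<close> on the surface.\<close>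
  have open_chart: "open (P ` X ` V)" "P ` X ` V \<subseteq> K"
    if X: "local_parametrization \<Sigma> W X" and V: "open V" "V \<subseteq> W \<inter> half_plane" for W X V
  proof -
    have XS: "X ` (W \<inter> half_plane) \<subseteq> \<Sigma>" using local_parametrization_subset[OF X] .
    then show "P ` X ` V \<subseteq> K" using V(2) unfolding K_def by blast
    obtain Y where "homeomorphism (W \<inter> half_plane) (X ` (W \<inter> half_plane)) X Y"
      using X by (auto simp: local_parametrization_def)
    then have "continuous_on (W \<inter> half_plane) X" "\<And>x. x \<in> W \<inter> half_plane \<Longrightarrow> Y (X x) = x"
      by (auto simp: homeomorphism_def)
    then have cX: "continuous_on V X" and Y: "\<And>x. x \<in> V \<Longrightarrow> Y (X x) = x"
      using V(2) continuous_on_subset by blast+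
    have "open ((P \<circ> X) ` V)"
    proof (rule invariance_of_domain[OF _ \<open>open V\<close>])
      show "continuous_on V (P \<circ> X)" by (rule continuous_on_compose[OF cX contP])
      show "inj_on (P \<circ> X) V"
      proof (rule inj_on_inverseI)
        fix x assume x: "x \<in> V"
        then have "X x \<in> \<Sigma>" using XS V(2) by blast
        then show "(Y \<circ> \<Phi>) ((P \<circ> X) x) = x" using \<Phi>P Y[OF x] by simp
      qed
    qed
    then show "open (P ` X ` V)" by (simp add: image_comp)
  qed
  have open_half: "open {x::real^2. 0 < x$2}" by (intro open_Collect_less continuous_intros)
  have half: "W \<inter> {x. 0 < x$2} \<subseteq> W \<inter> half_plane" for W by (auto simp: half_plane_def)
  have openW: "open (W \<inter> {x. 0 < x$2})" if "local_parametrization \<Sigma> W X" for W X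
    using that open_half by (auto simp: local_parametrization_def)
  have "open (K \<inter> ball c 1)"
  proof (subst open_subopen, intro ballI)
    fix s assume "s \<in> K \<inter> ball c 1"
    then obtain x where x: "x \<in> \<Sigma>" "s = P x" and s: "s \<in> ball c 1" by (auto simp: K_def)
    then have "toroid_function \<rho> x < 1" using level by (simp add: c_def mem_ball_real2 del: mem_ball)
    \<comment> \<open>Points over the open disc lie off the torus and so are not boundary points of
      the surface; only interior chart points have to be treated.\<close>
    then have nb: "x \<notin> surface_boundary \<Sigma>" using bd frontier_toroid(1) by force
    obtain W X where X: "local_parametrization \<Sigma> W X" and "x \<in> X ` (W \<inter> half_plane)"
      using emb x unfolding embedded_surface_def by blast
    then obtain u where u: "u \<in> W" "u \<in> half_plane" "x = X u" by blast
    have "u$2 \<noteq> 0"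
    proof
      assume "u$2 = 0"
      then have "x \<in> surface_boundary \<Sigma>" using X u unfolding surface_boundary_def by blast
      then show False using nb by simp
    qed
    then have "u \<in> W \<inter> {x. 0 < x$2}" using u by (auto simp: half_plane_def)
    then have "s \<in> P ` X ` (W \<inter> {x. 0 < x$2}) \<inter> ball c 1" using u x s by blast
    moreover have "open (P ` X ` (W \<inter> {x. 0 < x$2}) \<inter> ball c 1)"
      using open_chart(1)[OF X openW[OF X] half] by (intro open_Int open_ball)
    moreover have "P ` X ` (W \<inter> {x. 0 < x$2}) \<inter> ball c 1 \<subseteq> K \<inter> ball c 1"
      using open_chart(2)[OF X openW[OF X] half] by blast
    ultimately show "\<exists>T. open T \<and> s \<in> T \<and> T \<subseteq> K \<inter> ball c 1" by blast
  qed
  then have "openin (top_of_set (ball c 1)) (K \<inter> ball c 1)"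
    by (intro open_subset) auto
  moreover have "closedin (top_of_set (ball c 1)) (K \<inter> ball c 1)"
    using compact_imp_closed[OF \<open>compact K\<close>] closedin_closed_Int by (metis Int_commute)
  ultimately have "K \<inter> ball c 1 = {} \<or> K \<inter> ball c 1 = ball c 1"
    using connected_clopen[of "ball c 1"] by auto
  \<comment> \<open>Every chart contains parameters off the edge. Their image is open and lies in
    the closed disc, hence in the open one.\<close>
  moreover have "K \<inter> ball c 1 \<noteq> {}"
  proof -
    obtain x where "x \<in> \<Sigma>" using \<open>\<Sigma> \<noteq> {}\<close> by blast
    then obtain W X where X: "local_parametrization \<Sigma> W X" and "x \<in> X ` (W \<inter> half_plane)"
      using emb unfolding embedded_surface_def by blast
    then obtain u where u: "u \<in> W \<inter> half_plane" by blast
    have "open W" using X by (simp add: local_parametrization_def)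
    have "eventually (\<lambda>t. u + t *\<^sub>R axis 2 1 \<in> W \<inter> half_plane) (at_right (0::real))"
      by (rule half_plane_curve[OF \<open>open W\<close> u]) (simp add: axis_def)
    then have "eventually (\<lambda>t. u + t *\<^sub>R axis 2 1 \<in> W \<inter> {x. 0 < x$2}) (at_right (0::real))"
      using eventually_at_right_less[of "0::real"]
      by eventually_elim (use u in \<open>auto simp: half_plane_def axis_def\<close>)
    then obtain t :: real where "u + t *\<^sub>R axis 2 1 \<in> W \<inter> {x. 0 < x$2}"
      using eventually_happens'[OF trivial_limit_at_right_real] by blast
    then have ne: "P ` X ` (W \<inter> {x. 0 < x$2}) \<noteq> {}" by blast
    have "P ` X ` (W \<inter> {x. 0 < x$2}) \<subseteq> interior (cball c 1)"
      using open_chart[OF X openW[OF X] half] \<open>K \<subseteq> cball c 1\<close> by (intro interior_maximal) auto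
    then have "P ` X ` (W \<inter> {x. 0 < x$2}) \<subseteq> ball c 1" by simp
    then show ?thesis using ne open_chart(2)[OF X openW[OF X] half] by blast
  qed
  ultimately have "ball c 1 \<subseteq> K" by blast
  then have "cball c 1 \<subseteq> K"
    using closure_minimal[OF _ compact_imp_closed[OF \<open>compact K\<close>]] by (metis closure_ball zero_less_one)
  then have "K = cball c 1" using \<open>K \<subseteq> cball c 1\<close> by simp
  then have "\<Sigma> = rotation_x3 \<theta> ` vertical_slice \<rho>"
    using \<open>\<Sigma> = \<Phi> ` K\<close> by (simp add: rotated_vertical_slice \<Phi>_def c_def)
  then show ?thesis by blast
qed

end
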